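(* Let $N\ge1$ be an integer, $\mu>0$, $R>0$, and let $1<p\le p_G(N+\mu)$, where $p_G(N+\mu)=1+\frac{2}{N+\mu-1}$. Assume that $f\in H^1(\mathbb{R}^N)$ and $g\in L^2(\mathbb{R}^N)$ are non-negative functions which are compactly supported in $B_{\mathbb{R}^N}(0,R)$ and neither of which vanishes everywhere. Then there exist a constant $\varepsilon_0=\varepsilon_0(f,g,N,R,p,\mu)>0$ and a constant $C>0$ independent of $\varepsilon$ such that the following holds for every $0<\varepsilon\le\varepsilon_0$: if $u$ is an energy solution on $[0,T_\varepsilon)$ of $$u_{tt}-\Delta u+\frac{\mu}{1+t}u_t=|u_t|^p \ \text{ in } \mathbb{R}^N\times[0,\infty),\qquad u(x,0)=\varepsilon f(x),\quad u_t(x,0)=\varepsilon g(x),\quad x\in\mathbb{R}^N,$$ such that $\mathrm{supp}(u)\subset\{(x,t)\in\mathbb{R}^N\times[0,\infty): |x|\le t+R\}$, then $$T_\varepsilon\le\begin{cases} C\,\varepsilon^{-\frac{2(p-1)}{2-(N+\mu-1)(p-1)}} & \text{if } 1<p<p_G(N+\mu),\\[4pt] \exp\big(C\varepsilon^{-(p-1)}\big) & \text{if } p=p_G(N+\mu).\end{cases}$$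
   Context: Energy (weak) solution: $u$ is an energy solution of the Cauchy problem on $[0,T)$ if $u\in \mathcal{C}([0,T),H^1(\mathbb{R}^N))\cap \mathcal{C}^1([0,T),L^2(\mathbb{R}^N))$, $u_t\in L^p_{loc}((0,T)\times\mathbb{R}^N)$, the initial conditions $u(\cdot,0)=\varepsilon f$, $u_t(\cdot,0)=\varepsilon g$ hold, and for all $\Phi\in\mathcal{C}_0^\infty(\mathbb{R}^N\times[0,T))$ and all $t\in[0,T)$, $$\int_{\mathbb{R}^N}u_t(x,t)\Phi(x,t)\,dx-\int_{\mathbb{R}^N}u_t(x,0)\Phi(x,0)\,dx-\int_0^t\int_{\mathbb{R}^N}u_t(x,s)\Phi_t(x,s)\,dx\,ds+\int_0^t\int_{\mathbb{R}^N}\nabla u(x,s)\cdot\nabla\Phi(x,s)\,dx\,ds$$ $$+\int_0^t\int_{\mathbb{R}^N}\frac{\mu}{1+s}u_t(x,s)\Phi(x,s)\,dx\,ds=\int_0^t\int_{\mathbb{R}^N}|u_t(x,s)|^p\,\Phi(x,s)\,dx\,ds.$$ *)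

theory Defs
  imports "HOL-Analysis.Analysis"
begin

text \<open>
  Elements of the spaces L2, H1 and Lp are represented by Lebesgue measurable functions, with
  equality almost everywhere. A function of space and time is represented by the curve
  \<open>u :: real \<Rightarrow> 'a \<Rightarrow> real\<close> of its time slices, so that \<open>u t x\<close> is the value usually written
  \<open>u(x,t)\<close>; points of space-time are pairs \<open>(x, t)\<close>.
\<close>

subsection \<open>Smooth functions\<close>

primrec C_k :: "nat \<Rightarrow> ('a::euclidean_space \<Rightarrow> real) \<Rightarrow> bool" where
  "C_k 0 \<phi> \<longleftrightarrow> continuous_on UNIV \<phi>"
| "C_k (Suc k) \<phi> \<longleftrightarrow> (\<forall>x. \<phi> differentiable (at x)) \<and>
     (\<forall>i\<in>Basis. C_k k (\<lambda>x. frechet_derivative \<phi> (at x) i))"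

definition smooth :: "('a::euclidean_space \<Rightarrow> real) \<Rightarrow> bool" where
  "smooth \<phi> \<longleftrightarrow> (\<forall>k. C_k k \<phi>)"

text \<open>
  Smooth functions on \<open>S\<close> with compact support in \<open>S\<close>. For sets \<open>S\<close> that are not open, such as
  \<open>UNIV \<times> {0..<T}\<close>, smoothness up to the boundary means being the restriction of a smooth function
  on the whole space. The values outside \<open>S\<close> are irrelevant, and the support may touch the part
  of the boundary that belongs to \<open>S\<close>.
\<close>
definition test_functions :: "'a::euclidean_space set \<Rightarrow> ('a \<Rightarrow> real) set" where
  "test_functions S =
     {\<phi>. smooth \<phi> \<and> (\<exists>K. compact K \<and> K \<subseteq> S \<and> (\<forall>x\<in>S - K. \<phi> x = 0))}"

definition grad :: "('a::euclidean_space \<Rightarrow> real) \<Rightarrow> 'a \<Rightarrow> 'a" where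
  "grad \<phi> x = (\<Sum>i\<in>Basis. frechet_derivative \<phi> (at x) i *\<^sub>R i)"


subsection \<open>Function spaces\<close>

definition L2 :: "('a::euclidean_space \<Rightarrow> 'b::euclidean_space) set" where
  "L2 = {f. f \<in> borel_measurable lebesgue \<and> integrable lebesgue (\<lambda>x. (norm (f x))\<^sup>2)}"

definition L2_norm :: "('a::euclidean_space \<Rightarrow> 'b::euclidean_space) \<Rightarrow> real" where
  "L2_norm f = sqrt (LINT x|lebesgue. (norm (f x))\<^sup>2)"

definition has_weak_gradient :: "('a::euclidean_space \<Rightarrow> real) \<Rightarrow> ('a \<Rightarrow> 'a) \<Rightarrow> bool" where
  "has_weak_gradient f G \<longleftrightarrow>
     (\<forall>\<phi>\<in>test_functions UNIV. \<forall>i\<in>Basis.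
        (LINT x|lebesgue. f x * (grad \<phi> x \<bullet> i)) = - (LINT x|lebesgue. (G x \<bullet> i) * \<phi> x))"

definition H1 :: "('a::euclidean_space \<Rightarrow> real) set" where
  "H1 = {f \<in> L2. \<exists>G\<in>L2. has_weak_gradient f G}"

text \<open>Meaningful for \<open>f \<in> H1\<close>, where it is determined up to null sets.\<close>
definition weak_grad :: "('a::euclidean_space \<Rightarrow> real) \<Rightarrow> 'a \<Rightarrow> 'a" where
  "weak_grad f = (SOME G. G \<in> L2 \<and> has_weak_gradient f G)"

definition H1_norm :: "('a::euclidean_space \<Rightarrow> real) \<Rightarrow> real" where
  "H1_norm f = sqrt ((L2_norm f)\<^sup>2 + (L2_norm (weak_grad f))\<^sup>2)"

definition Lp_loc :: "real \<Rightarrow> 'a::euclidean_space set \<Rightarrow> ('a \<Rightarrow> real) set" where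
  "Lp_loc p S = {f. \<forall>K. compact K \<and> K \<subseteq> S \<longrightarrow>
     set_borel_measurable lebesgue K f \<and> set_integrable lebesgue K (\<lambda>z. \<bar>f z\<bar> powr p)}"


subsection \<open>Curves in function spaces\<close>

definition cont_curve ::
  "('a \<Rightarrow> real) set \<Rightarrow> (('a \<Rightarrow> real) \<Rightarrow> real) \<Rightarrow> real set \<Rightarrow> (real \<Rightarrow> 'a \<Rightarrow> real) \<Rightarrow> bool" where
  "cont_curve X nrm J u \<longleftrightarrow> (\<forall>t\<in>J. u t \<in> X) \<and>
     (\<forall>t\<in>J. ((\<lambda>s. nrm (\<lambda>x. u s x - u t x)) \<longlongrightarrow> 0) (at t within J))"

text \<open>\<open>v\<close> is the (strong) derivative in L2 of the curve \<open>u\<close>, one-sided at end points in \<open>J\<close>.\<close>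
definition has_L2_derivative ::
  "(real \<Rightarrow> 'a::euclidean_space \<Rightarrow> real) \<Rightarrow> (real \<Rightarrow> 'a \<Rightarrow> real) \<Rightarrow> real set \<Rightarrow> bool" where
  "has_L2_derivative u v J \<longleftrightarrow>
     (\<forall>t\<in>J. ((\<lambda>s. L2_norm (\<lambda>x. (u s x - u t x) / (s - t) - v t x)) \<longlongrightarrow> 0) (at t within J))"


subsection \<open>Supports\<close>

definition ess_support :: "('a::euclidean_space \<Rightarrow> real) \<Rightarrow> 'a set" where
  "ess_support f =
     {x. \<forall>U. open U \<and> x \<in> U \<longrightarrow> \<not> (AE y in lebesgue. y \<in> U \<longrightarrow> f y = 0)}"

text \<open>
  The space-time support of a curve on the time set \<open>J\<close>. The null sets are taken slice by slice, so
  that the support depends only on the classes of the slices; for curves that are continuous into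
  L2 this is the essential support of the function of \<open>(x, t)\<close>.
\<close>
definition spacetime_support ::
  "real set \<Rightarrow> (real \<Rightarrow> 'a::euclidean_space \<Rightarrow> real) \<Rightarrow> ('a \<times> real) set" where
  "spacetime_support J u =
     {(x, t). t \<in> J \<and> (\<forall>U. open U \<and> (x, t) \<in> U \<longrightarrow>
        (\<exists>s\<in>J. \<not> (AE y in lebesgue. (y, s) \<in> U \<longrightarrow> u s y = 0)))}"


subsection \<open>Energy solutions\<close>

definition lifespan_interval :: "ereal \<Rightarrow> real set" where
  "lifespan_interval T = {t. 0 \<le> t \<and> ereal t < T}"

text \<open>
  The function \<open>v\<close> is a jointly measurable representative of \<open>u\<^sub>t\<close>. Local integrability on
  the open set \<open>(0,T) \<times> \<real>\<^sup>N\<close> does not control the nonlinear term near \<open>t = 0\<close>; since an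
  integral that does not exist has the value 0 here, its existence is required separately.
  All other integrals exist by the regularity of \<open>u\<close>.
\<close>
definition weak_identity ::
  "real \<Rightarrow> real \<Rightarrow> real \<Rightarrow> (real \<Rightarrow> 'a::euclidean_space \<Rightarrow> real) \<Rightarrow> (real \<Rightarrow> 'a \<Rightarrow> real) \<Rightarrow>
   ('a \<times> real \<Rightarrow> real) \<Rightarrow> bool" where
  "weak_identity \<mu> p t u v \<Phi> \<longleftrightarrow>
     set_integrable lebesgue (UNIV \<times> {0..t}) (\<lambda>(x, s). \<bar>v s x\<bar> powr p * \<Phi> (x, s)) \<and>
     (LINT x|lebesgue. v t x * \<Phi> (x, t)) - (LINT x|lebesgue. v 0 x * \<Phi> (x, 0))
     - (LINT s:{0..t}|lebesgue. LINT x|lebesgue. v s x * deriv (\<lambda>\<tau>. \<Phi> (x, \<tau>)) s)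
     + (LINT s:{0..t}|lebesgue. LINT x|lebesgue. weak_grad (u s) x \<bullet> grad (\<lambda>y. \<Phi> (y, s)) x)
     + (LINT s:{0..t}|lebesgue. LINT x|lebesgue. \<mu> / (1 + s) * v s x * \<Phi> (x, s))
     = (LINT s:{0..t}|lebesgue. LINT x|lebesgue. \<bar>v s x\<bar> powr p * \<Phi> (x, s))"

definition energy_solution ::
  "real \<Rightarrow> real \<Rightarrow> ereal \<Rightarrow> ('a::euclidean_space \<Rightarrow> real) \<Rightarrow> ('a \<Rightarrow> real) \<Rightarrow>
   (real \<Rightarrow> 'a \<Rightarrow> real) \<Rightarrow> bool" where
  "energy_solution \<mu> p T u\<^sub>0 u\<^sub>1 u \<longleftrightarrow> 0 < T \<and>
     (let J = lifespan_interval T in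
      cont_curve H1 H1_norm J u \<and>
      (\<exists>v. cont_curve L2 L2_norm J v \<and> has_L2_derivative u v J \<and>
           (\<lambda>(x, t). v t x) \<in> Lp_loc p (UNIV \<times> (J - {0})) \<and>
           (AE x in lebesgue. u 0 x = u\<^sub>0 x) \<and> (AE x in lebesgue. v 0 x = u\<^sub>1 x) \<and>
           (\<forall>\<Phi>\<in>test_functions (UNIV \<times> J). \<forall>t\<in>J. weak_identity \<mu> p t u v \<Phi>)))"

definition p_G :: "real \<Rightarrow> real" where
  "p_G d = 1 + 2 / (d - 1)"

end

theory Submission
  imports Defs "HOL-Probability.Distributions"
begin

text \<open>
  The theorem is reduced to a scalar differential inequality by testing the equation with a single
  plane exponential. Fix a coordinate direction \<open>e\<close> and put
  \<open>Q(t) = \<integral> u(x,t) exp (x \<bullet> e) dx\<close> and \<open>P = Q'\<close>. Since \<open>exp (x \<bullet> e)\<close> is its own Laplacian,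
  \<open>P' = Q - \<mu> / (1 + t) P + F\<close> with \<open>F(t) = \<integral> |u\<^sub>t|\<^sup>p exp (x \<bullet> e) dx\<close>. By the support
  hypothesis all integrals live on the ball of radius \<open>t + R\<close>, so the exponential may be cut off
  to become an admissible test function (\<open>weak_identity_cut_exp\<close>).

  On that ball the exponential has mass at most \<open>C e\<^sup>t (1 + t) powr ((N - 1) / 2)\<close>
  (\<open>exp_inner_ball_bound\<close>): it concentrates in a cap at the pole \<open>(t + R) e\<close>, of width
  about \<open>sqrt t\<close> in the \<open>N - 1\<close> directions orthogonal to \<open>e\<close>. A plane wave thus has the same
  growth as its average over all directions. Hoelder's inequality (\<open>reverse_Hoelder\<close>) now bounds \<open>F\<close> below by
  \<open>\<kappa> |P|\<^sup>p exp (-(p - 1) t) (1 + t) powr (-(N - 1) (p - 1) / 2)\<close>.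

  What remains concerns \<open>P\<close> and \<open>Q\<close> only (locale \<open>damped_ode\<close>). The data make \<open>P\<close> and \<open>Q\<close>
  positive at time 0, both stay positive, and \<open>P \<ge> c Q\<close> is preserved. The combination
  \<open>Z = P + (1 + \<mu> / (2 (1 + t))) Q\<close> is comparable to \<open>P\<close> and, up to an integrable error in the
  rate, grows at least like \<open>e\<^sup>t (1 + t) powr (-\<mu> / 2)\<close>. Dividing this factor out leaves a
  function \<open>X\<close> of size \<open>\<epsilon>\<close> at time 0 with \<open>X' \<ge> k X\<^sup>p (1 + t) powr (-\<theta>)\<close>, where
  \<open>\<theta> = (N + \<mu> - 1) (p - 1) / 2\<close>. Hence \<open>\<integral> (1 + t) powr (-\<theta>) dt\<close> over the life span is at most a
  constant times \<open>\<epsilon> powr (-(p - 1))\<close>. The condition \<open>p \<le> p_G (N + \<mu>)\<close> says \<open>\<theta> \<le> 1\<close>, so the integral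
  diverges with the length of the interval: like a power if \<open>\<theta> < 1\<close> and like a logarithm if
  \<open>\<theta> = 1\<close>, which gives the two bounds.

  The function \<open>F\<close> is merely integrable in time, so \<open>P\<close> need not be differentiable. The
  differential inequalities are therefore read in the sense of lower right derivatives.
\<close>

section \<open>Smooth functions and smooth plateaus\<close>

lemma C_k_SucI:
  assumes "\<And>x. (\<phi> has_derivative \<phi>' x) (at x)"
    and "\<And>i. i \<in> Basis \<Longrightarrow> C_k k (\<lambda>x. \<phi>' x i)"
  shows "C_k (Suc k) \<phi>"
proof -
  have "frechet_derivative \<phi> (at x) = \<phi>' x" for x
    using frechet_derivative_at[OF assms(1)] by simp
  then show ?thesis
    using assms by (auto simp: differentiable_def)
qed

lemma C_k_has_derivative:
  assumes "C_k (Suc k) \<phi>"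
  shows "(\<phi> has_derivative frechet_derivative \<phi> (at x)) (at x)"
  using assms by (simp add: frechet_derivative_works)

lemma C_k_Suc_imp: "C_k (Suc k) \<phi> \<Longrightarrow> C_k k \<phi>"
proof (induction k arbitrary: \<phi>)
  case 0
  then show ?case
    by (auto simp: differentiable_imp_continuous_within continuous_on_eq_continuous_within)
qed auto

lemma C_k_const: "C_k k (\<lambda>x. c)"
proof (induction k arbitrary: c)
  case (Suc k)
  show ?case
    by (rule C_k_SucI[where \<phi>'="\<lambda>_ _. 0"]) (use Suc in auto)
qed auto

lemma C_k_linear: "bounded_linear L \<Longrightarrow> C_k k L"
proof (cases k)
  case 0
  then show "bounded_linear L \<Longrightarrow> C_k k L"
    by (simp add: linear_continuous_on)
next
  case (Suc n)
  assume "bounded_linear L"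
  then show "C_k k L"
    unfolding Suc
    by (intro C_k_SucI[where \<phi>'="\<lambda>_. L"] bounded_linear_imp_has_derivative C_k_const)
qed

lemma C_k_add: "C_k k \<phi> \<Longrightarrow> C_k k \<psi> \<Longrightarrow> C_k k (\<lambda>x. \<phi> x + \<psi> x)"
proof (induction k arbitrary: \<phi> \<psi>)
  case (Suc k)
  note d = C_k_has_derivative[OF Suc.prems(1)] C_k_has_derivative[OF Suc.prems(2)]
  show ?case
    by (rule C_k_SucI[OF has_derivative_add[OF d]]) (use Suc in auto)
qed (auto intro: continuous_on_add)

lemma C_k_mult: "C_k k \<phi> \<Longrightarrow> C_k k \<psi> \<Longrightarrow> C_k k (\<lambda>x. \<phi> x * \<psi> x)"
proof (induction k arbitrary: \<phi> \<psi>)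
  case (Suc k)
  note d = C_k_has_derivative[OF Suc.prems(1)] C_k_has_derivative[OF Suc.prems(2)]
  show ?case
    by (rule C_k_SucI[OF has_derivative_mult[OF d]])
      (use Suc C_k_Suc_imp in \<open>auto intro!: C_k_add Suc.IH\<close>)
qed (auto intro: continuous_on_mult)

text \<open>
  The inductive step closes because \<open>(1 / \<phi>)' = - \<phi>' (1 / \<phi>)\<^sup>2\<close> involves \<open>1 / \<phi>\<close> only undifferentiated.
\<close>
lemma C_k_inverse:
  assumes "\<And>x. \<phi> x \<noteq> 0"
  shows "C_k k \<phi> \<Longrightarrow> C_k k (\<lambda>x. inverse (\<phi> x))"
proof (induction k)
  case 0
  then show ?case using assms by (auto intro: continuous_on_inverse)
next
  case (Suc k)
  have inv: "C_k k (\<lambda>x. inverse (\<phi> x))"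
    by (rule Suc.IH[OF C_k_Suc_imp[OF Suc.prems]])
  have d: "((\<lambda>x. inverse (\<phi> x)) has_derivative
      (\<lambda>h. (-1) * (inverse (\<phi> x) * (frechet_derivative \<phi> (at x) h * inverse (\<phi> x))))) (at x)" for x
    using Deriv.has_derivative_inverse[OF assms C_k_has_derivative[OF Suc.prems]]
    by (simp add: mult.assoc)
  show ?case
    by (rule C_k_SucI[OF d]) (intro C_k_mult C_k_const inv, use Suc.prems in auto)
qed

lemma C_k_compose:
  fixes g :: "real \<Rightarrow> real"
  shows "C_k k g \<Longrightarrow> C_k k \<phi> \<Longrightarrow> C_k k (\<lambda>x. g (\<phi> x))"
proof (induction k arbitrary: g)
  case 0
  then show ?case
    by (auto intro: continuous_on_compose2)
next
  case (Suc k)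
  have lin: "frechet_derivative g (at y) h = h * frechet_derivative g (at y) 1" for y h
  proof -
    have "linear (frechet_derivative g (at y))"
      using Suc.prems(1) by (intro linear_frechet_derivative) simp
    from linear_scale[OF this, of h 1] show ?thesis by simp
  qed
  have d: "((\<lambda>x. g (\<phi> x)) has_derivative
      (\<lambda>h. frechet_derivative \<phi> (at x) h * frechet_derivative g (at (\<phi> x)) 1)) (at x)" for x
  proof -
    have "(\<lambda>h. frechet_derivative g (at (\<phi> x)) (frechet_derivative \<phi> (at x) h)) =
        (\<lambda>h. frechet_derivative \<phi> (at x) h * frechet_derivative g (at (\<phi> x)) 1)"
      by (rule ext, rule lin)
    then show ?thesis
      using has_derivative_compose[OF C_k_has_derivative[OF Suc.prems(2)]
        C_k_has_derivative[OF Suc.prems(1)], of x] by (simp only:)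
  qed
  have g': "C_k k (\<lambda>y. frechet_derivative g (at y) 1)"
    using Suc.prems(1) by simp
  show ?case
    by (rule C_k_SucI[OF d]) (intro C_k_mult Suc.IH[OF g'] C_k_Suc_imp[OF Suc.prems(2)],
      use Suc.prems(2) in auto)
qed

lemma smooth_const: "smooth (\<lambda>x. c)"
  and smooth_linear: "bounded_linear L \<Longrightarrow> smooth L"
  and smooth_add: "smooth \<phi> \<Longrightarrow> smooth \<psi> \<Longrightarrow> smooth (\<lambda>x. \<phi> x + \<psi> x)"
  and smooth_mult: "smooth \<phi> \<Longrightarrow> smooth \<psi> \<Longrightarrow> smooth (\<lambda>x. \<phi> x * \<psi> x)"
  and smooth_inverse: "(\<And>x. \<phi> x \<noteq> 0) \<Longrightarrow> smooth \<phi> \<Longrightarrow> smooth (\<lambda>x. inverse (\<phi> x))"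
  and smooth_compose: "smooth g \<Longrightarrow> smooth \<phi> \<Longrightarrow> smooth (\<lambda>x. g (\<phi> x))"
  by (auto simp: smooth_def C_k_const C_k_linear C_k_add C_k_mult C_k_inverse C_k_compose)

lemma smooth_sum: "(\<And>i. i \<in> I \<Longrightarrow> smooth (\<phi> i)) \<Longrightarrow> smooth (\<lambda>x. \<Sum>i\<in>I. \<phi> i x)"
  by (induction I rule: infinite_finite_induct) (auto intro: smooth_const smooth_add)

lemma smooth_partial: "smooth \<phi> \<Longrightarrow> i \<in> Basis \<Longrightarrow> smooth (\<lambda>x. frechet_derivative \<phi> (at x) i)"
  unfolding smooth_def
proof
  fix k assume "\<forall>k. C_k k \<phi>" "i \<in> Basis"
  then have "C_k (Suc k) \<phi>" by blast
  then show "C_k k (\<lambda>x. frechet_derivative \<phi> (at x) i)" using \<open>i \<in> Basis\<close> by simp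
qed

lemma smooth_continuous: "smooth \<phi> \<Longrightarrow> continuous_on UNIV \<phi>"
  unfolding smooth_def using C_k.simps(1) by blast

text \<open>
  On the line it is enough to exhibit a sequence in which each function is the derivative of its
  predecessor.
\<close>
lemma smooth_realI:
  fixes g :: "nat \<Rightarrow> real \<Rightarrow> real"
  assumes "\<And>n x. (g n has_real_derivative g (Suc n) x) (at x)"
  shows "smooth (g n)"
proof -
  have "C_k k (g n)" for k
  proof (induction k arbitrary: n)
    case 0
    show ?case
      using assms DERIV_continuous by (fastforce simp: continuous_on_eq_continuous_within)
  next
    case (Suc k)
    show ?case
      by (rule C_k_SucI[where \<phi>'="\<lambda>x h. g (Suc n) x * h"])
        (use assms Suc in \<open>auto simp: has_field_derivative_def\<close>)
  qed
  then show ?thesis by (simp add: smooth_def)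
qed

lemma smooth_exp: "smooth (exp :: real \<Rightarrow> real)"
  using smooth_realI[of "\<lambda>_. exp"] DERIV_exp by blast

text \<open>
  For \<open>q = 1\<close> this is the classical smooth function that vanishes to infinite order at 0. Carrying a
  polynomial factor in \<open>1 / x\<close> makes the family closed under differentiation.
\<close>
definition flat :: "real poly \<Rightarrow> real \<Rightarrow> real" where
  "flat q x = (if x > 0 then poly q (1 / x) * exp (- (1 / x)) else 0)"

lemma poly_exp_tendsto_0: "((\<lambda>y. poly q y * exp (- y)) \<longlongrightarrow> (0::real)) at_top"
proof -
  have "((\<lambda>y. \<Sum>i\<le>degree q. coeff q i * (y ^ i / exp y)) \<longlongrightarrow> (\<Sum>i\<le>degree q. coeff q i * 0)) at_top"
    by (intro tendsto_intros tendsto_power_div_exp_0)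
  moreover have "(\<lambda>y. \<Sum>i\<le>degree q. coeff q i * (y ^ i / exp y)) = (\<lambda>y. poly q y * exp (- y))"
    by (simp add: poly_altdef sum_distrib_right exp_minus divide_inverse mult.assoc)
  ultimately show ?thesis by simp
qed

text \<open>
  The polynomial on the right comes from
  \<open>(q (1 / x) exp (-1 / x))' = (q - q') (1 / x) x\<^sup>-\<^sup>2 exp (-1 / x)\<close>.
\<close>
lemma DERIV_flat:
  "(flat q has_real_derivative flat ([:0, 0, 1:] * (q - pderiv q)) x) (at x)"
proof -
  consider "x > 0" | "x = 0" | "x < 0" by linarith
  then show ?thesis
  proof cases
    case 1
    have "((\<lambda>x. poly q (1 / x) * exp (- (1 / x))) has_real_derivative
        flat ([:0, 0, 1:] * (q - pderiv q)) x) (at x)"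
      using 1 unfolding flat_def
      by (auto intro!: derivative_eq_intros simp: field_simps power2_eq_square)
    then show ?thesis
      by (rule has_field_derivative_transform_within_open[where S="{0<..}"])
        (use 1 in \<open>auto simp: flat_def\<close>)
  next
    case 2
    have r: "((\<lambda>h. flat q h / h) \<longlongrightarrow> 0) (at_right 0)"
    proof -
      have "((\<lambda>h. poly (pCons 0 q) (inverse h) * exp (- inverse h)) \<longlongrightarrow> 0) (at_right (0::real))"
        by (rule filterlim_compose[OF poly_exp_tendsto_0 filterlim_inverse_at_top_right])
      then show ?thesis
        by (rule Lim_transform_eventually)
          (auto simp: eventually_at_right_less flat_def field_simps
            intro!: eventually_mono[OF eventually_at_right_less])
    qed
    have l: "((\<lambda>h. flat q h / h) \<longlongrightarrow> 0) (at_left 0)"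
      by (rule tendsto_eventually)
        (auto simp: flat_def eventually_at_filter)
    have "((\<lambda>h. flat q h / h) \<longlongrightarrow> 0) (at 0)"
      using filterlim_split_at[OF l r] .
    then show ?thesis
      using 2 by (simp add: DERIV_def flat_def)
  next
    case 3
    have "((\<lambda>x. 0) has_real_derivative flat ([:0, 0, 1:] * (q - pderiv q)) x) (at x)"
      using 3 by (simp add: flat_def)
    then show ?thesis
      by (rule has_field_derivative_transform_within_open[where S="{..<0}"])
        (use 3 in \<open>auto simp: flat_def\<close>)
  qed
qed

lemma smooth_flat: "smooth (flat q)"
proof -
  define r where "r = rec_nat q (\<lambda>_ s. [:0, 0, 1:] * (s - pderiv s))"
  have "smooth (flat (r 0))"
    by (rule smooth_realI[of "\<lambda>n. flat (r n)"]) (use DERIV_flat in \<open>simp add: r_def\<close>)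
  then show ?thesis by (simp add: r_def)
qed

lemma flat_1_nonneg: "0 \<le> flat 1 x" and flat_1_pos: "0 < x \<Longrightarrow> 0 < flat 1 x"
  by (auto simp: flat_def)

lemma flat_nonpos: "x \<le> 0 \<Longrightarrow> flat q x = 0"
  by (simp add: flat_def)

text \<open>
  A smooth transition from 0 on \<open>x \<le> 0\<close> to 1 on \<open>x \<ge> 1\<close>.
\<close>
definition smooth_step :: "real \<Rightarrow> real" where
  "smooth_step x = flat 1 x * inverse (flat 1 x + flat 1 (1 - x))"

lemma flat_sum_pos: "0 < flat 1 x + flat 1 (1 - x)"
  using flat_1_nonneg[of x] flat_1_nonneg[of "1 - x"] flat_1_pos[of x] flat_1_pos[of "1 - x"]
  by (cases "x > 0") (auto simp: add_pos_nonneg add_nonneg_pos)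

lemma smooth_affine: "smooth (\<lambda>x::real. a + b * x)"
  by (intro smooth_add smooth_const smooth_linear bounded_linear_mult_right)

lemma smooth_smooth_step: "smooth smooth_step"
proof -
  have "smooth (\<lambda>x. flat 1 x + flat 1 (1 + (-1) * x))"
    by (intro smooth_add smooth_flat smooth_compose[OF smooth_flat] smooth_affine)
  then have "smooth (\<lambda>x. inverse (flat 1 x + flat 1 (1 - x)))"
    using flat_sum_pos by (intro smooth_inverse) (auto simp: less_imp_neq[symmetric])
  then show ?thesis
    unfolding smooth_step_def[abs_def] by (intro smooth_mult smooth_flat)
qed

lemma smooth_step_0: "x \<le> 0 \<Longrightarrow> smooth_step x = 0"
  by (simp add: smooth_step_def flat_nonpos)

lemma smooth_step_1: "1 \<le> x \<Longrightarrow> smooth_step x = 1"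
  using flat_sum_pos[of x] by (simp add: smooth_step_def flat_nonpos)

lemma smooth_step_nonneg: "0 \<le> smooth_step x"
  using flat_sum_pos[of x] flat_1_nonneg[of x] by (simp add: smooth_step_def)

lemma smooth_norm_sq:
  fixes L :: "'a::euclidean_space \<Rightarrow> 'b::euclidean_space"
  assumes "bounded_linear L"
  shows "smooth (\<lambda>x. (norm (L x))\<^sup>2)"
proof -
  have "smooth (\<lambda>x. L x \<bullet> b)" for b
    by (intro smooth_linear bounded_linear_compose[OF bounded_linear_inner_left assms])
  then have "smooth (\<lambda>x. \<Sum>b\<in>Basis. (L x \<bullet> b) * (L x \<bullet> b))"
    by (intro smooth_sum smooth_mult)
  then show ?thesis
    by (simp add: power2_norm_eq_inner flip: euclidean_inner)
qed

section \<open>Square integrable functions, slices and supports\<close>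

text \<open>
  Lebesgue measure on the product is the completion of the product measure, so null sets have to be
  enlarged to Borel null sets before Fubini's theorem applies.
\<close>
lemma AE_lebesgue_product_commute:
  assumes "AE z in lebesgue. Q (z :: 'a::euclidean_space \<times> real)"
  shows "AE s in lebesgue. AE x in lebesgue. Q (x, s)"
proof -
  have "AE z in lborel \<Otimes>\<^sub>M lborel. Q z"
    unfolding lborel_prod using assms by (simp add: AE_completion_iff)
  then obtain N where N: "{z \<in> space (lborel \<Otimes>\<^sub>M lborel). \<not> Q z} \<subseteq> N"
      "emeasure (lborel \<Otimes>\<^sub>M lborel) N = 0" "N \<in> sets (lborel \<Otimes>\<^sub>M (lborel :: real measure))"
    by (rule AE_E)
  then have "AE z in lborel \<Otimes>\<^sub>M lborel. z \<notin> N"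
    by (intro AE_not_in) auto
  then have "AE x in lborel. AE s in lborel. (x, s) \<notin> N"
    by (rule lborel_pair.AE_pair)
  moreover have [measurable]: "N \<in> sets (borel \<Otimes>\<^sub>M borel)"
    using N(3) by simp
  have "Measurable.pred (lborel \<Otimes>\<^sub>M lborel) (\<lambda>z. (fst z, snd z) \<notin> N)"
    by measurable
  ultimately have "AE s in lborel. AE x in lborel. (x, s) \<notin> N"
    by (subst lborel_pair.AE_commute[symmetric]) (simp_all add: pred_def)
  then show ?thesis
    using N(1) by (auto simp: AE_completion_iff space_pair_measure elim!: eventually_mono)
qed

text \<open>
  Slicing of a Lebesgue integrable function, which need not be measurable for the product of the
  Lebesgue sigma-algebras, by passing to a Borel representative.
\<close>
lemma lebesgue_Fubini_snd:
  fixes h :: "'a::euclidean_space \<times> real \<Rightarrow> real"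
  assumes "integrable lebesgue h"
  shows "AE s in lebesgue. integrable lebesgue (\<lambda>x. h (x, s))"
    and "integrable lebesgue (\<lambda>s. LINT x|lebesgue. h (x, s))"
proof -
  obtain h' where h'[measurable]: "h' \<in> borel_measurable lborel" and eq: "AE z in lborel. h z = h' z"
    using completion_ex_borel_measurable_real[of h lborel] assms by auto
  have eq': "AE z in lebesgue. h z = h' z"
    using eq by (rule AE_completion)
  have "integrable lebesgue h'"
    using assms integrable_cong_AE[OF _ measurable_completion[OF h'] eq'] by auto
  then have int: "integrable (lborel \<Otimes>\<^sub>M lborel) (\<lambda>(x, s). h' (x, s))"
    by (simp add: integrable_completion lborel_prod)
  have ae: "AE s in lebesgue. AE x in lebesgue. h (x, s) = h' (x, s)"
    by (rule AE_lebesgue_product_commute[OF eq'])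
  have m: "h' \<in> borel_measurable (lborel \<Otimes>\<^sub>M lborel)"
    using h' by (simp add: lborel_prod)
  have m1: "(\<lambda>x. h' (x, s)) \<in> borel_measurable lborel" for s
    using measurable_Pair1[OF m, of s] by simp
  have *: "integrable lebesgue (\<lambda>x. h (x, s)) = integrable lborel (\<lambda>x. h' (x, s)) \<and>
      (LINT x|lebesgue. h (x, s)) = (LINT x|lborel. h' (x, s))"
    if "AE x in lebesgue. h (x, s) = h' (x, s)" for s
  proof -
    have "AE x in lebesgue. h' (x, s) = h (x, s)" using that by (auto elim!: eventually_mono)
    with measurable_completion[OF m1] have mh: "(\<lambda>x. h (x, s)) \<in> borel_measurable lebesgue"
      by (rule borel_measurable_AE)
    show ?thesis
      using integrable_cong_AE[OF mh measurable_completion[OF m1] that]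
        integral_cong_AE[OF mh measurable_completion[OF m1] that]
      by (simp add: integrable_completion integral_completion m1)
  qed
  have "AE s in lebesgue. integrable lborel (\<lambda>x. h' (x, s))"
    using lborel_pair.AE_integrable_snd[OF int] by (rule AE_completion)
  with ae show "AE s in lebesgue. integrable lebesgue (\<lambda>x. h (x, s))"
    by eventually_elim (use * in blast)
  have ae2: "AE s in lebesgue. (LINT x|lborel. h' (x, s)) = (LINT x|lebesgue. h (x, s))"
    using ae by eventually_elim (use * in simp)
  have "integrable lborel (\<lambda>s. LINT x|lborel. h' (x, s))"
    by (rule lborel_pair.integrable_snd[OF int])
  then have i: "integrable lebesgue (\<lambda>s. LINT x|lborel. h' (x, s))"
    by (subst integrable_completion) auto
  show "integrable lebesgue (\<lambda>s. LINT x|lebesgue. h (x, s))"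
    by (rule integrable_cong_AE_imp[OF i borel_measurable_AE[OF borel_measurable_integrable[OF i] ae2] ae2])
qed

lemma L2_real: "(f :: 'a::euclidean_space \<Rightarrow> real) \<in> L2 \<longleftrightarrow>
    f \<in> borel_measurable lebesgue \<and> integrable lebesgue (\<lambda>x. f x * f x)"
  by (simp add: L2_def power2_eq_square)

lemma integrable_L2_mult:
  fixes f g :: "'a::euclidean_space \<Rightarrow> real"
  assumes "f \<in> L2" "g \<in> L2"
  shows "integrable lebesgue (\<lambda>x. f x * g x)"
proof (rule Bochner_Integration.integrable_bound)
  show "integrable lebesgue (\<lambda>x. f x * f x + g x * g x)"
    using assms by (auto simp: L2_real)
  show "(\<lambda>x. f x * g x) \<in> borel_measurable lebesgue"
    using assms by (auto simp: L2_real)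
  have "\<bar>a * b\<bar> \<le> a * a + b * b" for a b :: real
  proof -
    have "2 * \<bar>a * b\<bar> \<le> a * a + b * b"
      using zero_le_power2[of "\<bar>a\<bar> - \<bar>b\<bar>"]
      by (simp add: power2_eq_square abs_mult algebra_simps)
    then show ?thesis by simp
  qed
  then show "AE x in lebesgue. norm (f x * g x) \<le> norm (f x * f x + g x * g x)"
    by (auto intro!: AE_I2 order_trans[OF _ abs_ge_self])
qed

lemma L2_diff:
  fixes f g :: "'a::euclidean_space \<Rightarrow> real"
  assumes "f \<in> L2" "g \<in> L2"
  shows "(\<lambda>x. f x - g x) \<in> L2"
proof -
  have "integrable lebesgue (\<lambda>x. f x * f x - 2 * (f x * g x) + g x * g x)"
    using assms integrable_L2_mult[OF assms] by (auto simp: L2_real)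
  then show ?thesis
    using assms by (auto simp: L2_real algebra_simps)
qed

lemma L2_scale:
  fixes f :: "'a::euclidean_space \<Rightarrow> real"
  assumes "f \<in> L2"
  shows "(\<lambda>x. f x / c) \<in> L2"
  using assms by (auto simp: L2_real)

lemma L2_Cauchy_Schwarz:
  fixes f g :: "'a::euclidean_space \<Rightarrow> real"
  assumes "f \<in> L2" "g \<in> L2"
  shows "\<bar>LINT x|lebesgue. f x * g x\<bar> \<le> L2_norm f * L2_norm g"
proof -
  define a b c where "a = (LINT x|lebesgue. f x * f x)" "b = (LINT x|lebesgue. f x * g x)"
    "c = (LINT x|lebesgue. g x * g x)"
  note int = integrable_L2_mult[OF assms] integrable_L2_mult[OF assms(1,1)] integrable_L2_mult[OF assms(2,2)]
  have quad: "0 \<le> a - 2 * l * b + l * l * c" for l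
  proof -
    have "0 \<le> (LINT x|lebesgue. (f x - l * g x) * (f x - l * g x))"
      by (intro Bochner_Integration.integral_nonneg) auto
    also have "(\<lambda>x. (f x - l * g x) * (f x - l * g x)) =
        (\<lambda>x. f x * f x - 2 * l * (f x * g x) + l * l * (g x * g x))"
      by (auto simp: algebra_simps)
    also have "(LINT x|lebesgue. f x * f x - 2 * l * (f x * g x) + l * l * (g x * g x)) =
        a - 2 * l * b + l * l * c"
      using int by (simp add: a_b_c_def)
    finally show ?thesis .
  qed
  have "b * b \<le> a * c"
  proof (cases "c = 0")
    case True
    have "b = 0"
    proof (rule ccontr)
      assume "b \<noteq> 0"
      \<comment> \<open>Any \<open>l\<close> with \<open>2 l b > a\<close> contradicts \<open>quad\<close>.\<close>
      then show False using quad[of "(a + 1) / (2 * b)"] True quad[of 0] by simp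
    qed
    then show ?thesis using True by simp
  next
    case False
    have "0 \<le> c" unfolding a_b_c_def by (intro Bochner_Integration.integral_nonneg) auto
    with False have "0 < c" by simp
    have "a - 2 * (b / c) * b + (b / c) * (b / c) * c = a - b * b / c"
      using \<open>0 < c\<close> by (simp add: field_simps)
    then show ?thesis using quad[of "b / c"] \<open>0 < c\<close> by (simp add: field_simps)
  qed
  then have "sqrt (b * b) \<le> sqrt (a * c)" by (rule real_sqrt_le_mono)
  then show ?thesis
    by (simp add: real_sqrt_mult L2_norm_def a_b_c_def power2_eq_square)
qed

text \<open>
  Norm continuity implies weak continuity; with the next lemma, this turns the regularity of an
  energy solution into regularity of its moments.
\<close>
lemma continuous_pairing_of_cont_curve:
  assumes v: "cont_curve L2 L2_norm J v" and \<phi>: "\<phi> \<in> L2"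
  shows "continuous_on J (\<lambda>t. LINT x|lebesgue. v t x * \<phi> x)"
  unfolding continuous_on_def
proof
  fix t assume t: "t \<in> J"
  have vL2: "v s \<in> L2" if "s \<in> J" for s using v that by (simp add: cont_curve_def)
  have "((\<lambda>s. L2_norm (\<lambda>x. v s x - v t x) * L2_norm \<phi>) \<longlongrightarrow> 0 * L2_norm \<phi>) (at t within J)"
    using v t by (intro tendsto_intros) (auto simp: cont_curve_def)
  then have lim: "((\<lambda>s. L2_norm (\<lambda>x. v s x - v t x) * L2_norm \<phi>) \<longlongrightarrow> 0) (at t within J)" by simp
  have "((\<lambda>s. (LINT x|lebesgue. v s x * \<phi> x) - (LINT x|lebesgue. v t x * \<phi> x)) \<longlongrightarrow> 0) (at t within J)"
  proof (rule Lim_null_comparison[OF _ lim])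
    show "\<forall>\<^sub>F s in at t within J. norm ((LINT x|lebesgue. v s x * \<phi> x) - (LINT x|lebesgue. v t x * \<phi> x))
        \<le> L2_norm (\<lambda>x. v s x - v t x) * L2_norm \<phi>"
      unfolding eventually_at_filter
    proof (intro always_eventually allI impI)
      fix s assume "s \<in> J"
      have "(LINT x|lebesgue. v s x * \<phi> x) - (LINT x|lebesgue. v t x * \<phi> x) =
          (LINT x|lebesgue. (v s x - v t x) * \<phi> x)"
        using integrable_L2_mult[OF vL2[OF \<open>s \<in> J\<close>] \<phi>] integrable_L2_mult[OF vL2[OF t] \<phi>]
        by (simp add: left_diff_distrib)
      then show "norm ((LINT x|lebesgue. v s x * \<phi> x) - (LINT x|lebesgue. v t x * \<phi> x))
        \<le> L2_norm (\<lambda>x. v s x - v t x) * L2_norm \<phi>"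
        using L2_Cauchy_Schwarz[OF L2_diff[OF vL2[OF \<open>s \<in> J\<close>] vL2[OF t]] \<phi>] by simp
    qed
  qed
  then show "((\<lambda>t. LINT x|lebesgue. v t x * \<phi> x) \<longlongrightarrow> (LINT x|lebesgue. v t x * \<phi> x)) (at t within J)"
    by (simp add: LIM_zero_iff)
qed

lemma pairing_has_derivative_of_has_L2_derivative:
  assumes d: "has_L2_derivative u v J" and u: "\<And>t. t \<in> J \<Longrightarrow> u t \<in> L2" and v: "\<And>t. t \<in> J \<Longrightarrow> v t \<in> L2"
    and \<phi>: "\<phi> \<in> L2" and t: "t \<in> J"
  shows "((\<lambda>t. LINT x|lebesgue. u t x * \<phi> x) has_real_derivative (LINT x|lebesgue. v t x * \<phi> x)) (at t within J)"
proof -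
  define q where "q s x = (u s x - u t x) / (s - t) - v t x" for s x
  have "((\<lambda>s. L2_norm (q s) * L2_norm \<phi>) \<longlongrightarrow> 0 * L2_norm \<phi>) (at t within J)"
    using d t by (intro tendsto_intros) (auto simp: has_L2_derivative_def q_def[abs_def])
  then have lim: "((\<lambda>s. L2_norm (q s) * L2_norm \<phi>) \<longlongrightarrow> 0) (at t within J)" by simp
  have "((\<lambda>s. ((LINT x|lebesgue. u s x * \<phi> x) - (LINT x|lebesgue. u t x * \<phi> x)) / (s - t)
      - (LINT x|lebesgue. v t x * \<phi> x)) \<longlongrightarrow> 0) (at t within J)"
  proof (rule Lim_null_comparison[OF _ lim])
    show "\<forall>\<^sub>F s in at t within J. norm (((LINT x|lebesgue. u s x * \<phi> x) - (LINT x|lebesgue. u t x * \<phi> x)) / (s - t)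
      - (LINT x|lebesgue. v t x * \<phi> x)) \<le> L2_norm (q s) * L2_norm \<phi>"
      unfolding eventually_at_filter
    proof (intro always_eventually allI impI)
      fix s assume "s \<in> J"
      note i = integrable_L2_mult[OF u[OF \<open>s \<in> J\<close>] \<phi>] integrable_L2_mult[OF u[OF t] \<phi>]
        integrable_L2_mult[OF v[OF t] \<phi>]
      have "(\<lambda>x. q s x * \<phi> x) = (\<lambda>x. (u s x * \<phi> x - u t x * \<phi> x) / (s - t) - v t x * \<phi> x)"
        by (auto simp: q_def left_diff_distrib)
      then have eq: "((LINT x|lebesgue. u s x * \<phi> x) - (LINT x|lebesgue. u t x * \<phi> x)) / (s - t)
          - (LINT x|lebesgue. v t x * \<phi> x) = (LINT x|lebesgue. q s x * \<phi> x)"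
        using i by simp
      have "q s \<in> L2"
        unfolding q_def[abs_def] using u[OF \<open>s \<in> J\<close>] u[OF t] v[OF t] by (intro L2_diff L2_scale)
      from L2_Cauchy_Schwarz[OF this \<phi>]
      show "norm (((LINT x|lebesgue. u s x * \<phi> x) - (LINT x|lebesgue. u t x * \<phi> x)) / (s - t)
          - (LINT x|lebesgue. v t x * \<phi> x)) \<le> L2_norm (q s) * L2_norm \<phi>"
        unfolding eq by simp
    qed
  qed
  then show ?thesis
    by (simp add: has_field_derivative_iff LIM_zero_iff)
qed

text \<open>
  By the Lindelof property countably many of the neighbourhoods cover the set.
\<close>
lemma AE_of_locally_AE:
  fixes S :: "'a::euclidean_space set"
  assumes "\<And>x. x \<in> S \<Longrightarrow> \<exists>U. open U \<and> x \<in> U \<and> (AE y in lebesgue. y \<in> U \<longrightarrow> Q y)"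
  shows "AE y in lebesgue. y \<in> S \<longrightarrow> Q y"
proof -
  define F where "F = {U. open U \<and> (AE y in lebesgue. y \<in> U \<longrightarrow> Q y)}"
  obtain F' where F': "F' \<subseteq> F" "countable F'" "\<Union>F' = \<Union>F"
    using Lindelof[of F] by (auto simp: F_def)
  have "AE y in lebesgue. \<forall>U\<in>F'. y \<in> U \<longrightarrow> Q y"
    using F' by (subst AE_ball_countable) (auto simp: F_def)
  then show ?thesis
  proof eventually_elim
    case (elim y)
    show ?case
    proof
      assume "y \<in> S"
      then have "y \<in> \<Union>F" using assms[of y] by (auto simp: F_def)
      then show "Q y" using elim F'(3) by blast
    qed
  qed
qed

lemma AE_zero_outside_ess_support: "AE x in lebesgue. x \<notin> ess_support f \<longrightarrow> f x = 0"
  using AE_of_locally_AE[of "- ess_support f" "\<lambda>x. f x = 0"] by (auto simp: ess_support_def)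

lemma AE_zero_outside_spacetime_support:
  fixes u :: "real \<Rightarrow> 'a::euclidean_space \<Rightarrow> real"
  assumes sub: "spacetime_support J u \<subseteq> {(x, t). 0 \<le> t \<and> norm x \<le> t + R}" and t: "t \<in> J"
  shows "AE x in lebesgue. t + R < norm x \<longrightarrow> u t x = 0"
proof -
  have "AE x in lebesgue. x \<in> {x. t + R < norm x} \<longrightarrow> u t x = 0"
  proof (rule AE_of_locally_AE)
    fix x :: 'a assume "x \<in> {x. t + R < norm x}"
    then have "(x, t) \<notin> spacetime_support J u" using sub by auto
    then obtain U where U: "open U" "(x, t) \<in> U" "AE y in lebesgue. (y, t) \<in> U \<longrightarrow> u t y = 0"
      using t by (auto simp: spacetime_support_def)
    have "open ((\<lambda>y. (y, t)) -` U)"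
      using U(1) by (intro open_vimage continuous_intros)
    then show "\<exists>V. open V \<and> x \<in> V \<and> (AE y in lebesgue. y \<in> V \<longrightarrow> u t y = 0)"
      using U(2,3) by (intro exI[of _ "(\<lambda>y. (y, t)) -` U"]) auto
  qed
  then show ?thesis by simp
qed

text \<open>
  Where \<open>u\<close> vanishes up to time \<open>t\<close>, so do its backward difference quotients and hence
  their limit. This transfers the support property from \<open>u\<close> to \<open>u\<^sub>t\<close> at positive times.
\<close>
lemma AE_zero_of_L2_derivative:
  assumes d: "has_L2_derivative u v J" and u: "\<And>t. t \<in> J \<Longrightarrow> u t \<in> L2" and v: "\<And>t. t \<in> J \<Longrightarrow> v t \<in> L2"
    and t: "t \<in> J" and r: "r < t" "{r..t} \<subseteq> J" and S: "S \<in> sets lebesgue"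
    and z: "\<And>s. s \<in> J \<Longrightarrow> s \<le> t \<Longrightarrow> AE x in lebesgue. x \<in> S \<longrightarrow> u s x = 0"
  shows "AE x in lebesgue. x \<in> S \<longrightarrow> v t x = 0"
proof -
  define q where "q s x = (u s x - u t x) / (s - t) - v t x" for s x
  define I where "I = (LINT x|lebesgue. indicator S x * (v t x * v t x))"
  have intv: "integrable lebesgue (\<lambda>x. v t x * v t x)" using v[OF t] by (simp add: L2_real)
  then have intI: "integrable lebesgue (\<lambda>x. indicator S x * (v t x * v t x))"
    using integrable_mult_indicator[OF S intv] by simp
  have le: "I \<le> (L2_norm (q s))\<^sup>2" if s: "s \<in> {r..<t}" for s
  proof -
    have "s \<in> J" using s r by auto
    then have "q s \<in> L2"
      unfolding q_def[abs_def] using u t v by (intro L2_diff L2_scale) auto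
    then have iq: "integrable lebesgue (\<lambda>x. q s x * q s x)" by (simp add: L2_real)
    have "AE x in lebesgue. indicator S x * (v t x * v t x) \<le> q s x * q s x"
      using z[OF \<open>s \<in> J\<close>] z[OF t] s by (auto elim!: eventually_elim2 simp: q_def indicator_def)
    then have "I \<le> (LINT x|lebesgue. q s x * q s x)"
      unfolding I_def by (intro integral_mono_AE intI iq)
    moreover have "0 \<le> (LINT x|lebesgue. q s x * q s x)"
      by (intro Bochner_Integration.integral_nonneg) auto
    ultimately show ?thesis by (simp add: L2_norm_def power2_eq_square)
  qed
  have "((\<lambda>s. L2_norm (q s)) \<longlongrightarrow> 0) (at t within J)"
    using d t by (simp add: has_L2_derivative_def q_def[abs_def])
  then have "((\<lambda>s. L2_norm (q s)) \<longlongrightarrow> 0) (at t within {r..t})"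
    using r(2) by (rule tendsto_within_subset)
  then have "((\<lambda>s. (L2_norm (q s))\<^sup>2) \<longlongrightarrow> 0\<^sup>2) (at t within {r..t})"
    by (intro tendsto_intros)
  then have "((\<lambda>s. (L2_norm (q s))\<^sup>2) \<longlongrightarrow> 0) (at_left t)"
    using r(1) by (simp add: at_within_Icc_at_left)
  then have "I \<le> 0"
  proof (rule tendsto_lowerbound)
    show "\<forall>\<^sub>F s in at_left t. I \<le> (L2_norm (q s))\<^sup>2"
      using eventually_at_left_real[OF r(1)] by eventually_elim (auto intro: le)
  qed simp
  moreover have "0 \<le> I" unfolding I_def by (intro Bochner_Integration.integral_nonneg) auto
  ultimately have "I = 0" by simp
  then have "AE x in lebesgue. indicator S x * (v t x * v t x) = 0"
    unfolding I_def by (subst (asm) integral_nonneg_eq_0_iff_AE[OF intI]) auto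
  then show ?thesis by eventually_elim (auto simp: indicator_def)
qed

section \<open>Mass of the plane exponential on balls\<close>

lemma nn_integral_exp_halfline:
  "(\<integral>\<^sup>+y. ennreal (indicator {..r} y * exp ((y + r) / 2)) \<partial>lborel) = ennreal (2 * exp r)"
proof -
  have "(\<integral>\<^sup>+y. ennreal (indicator {..r} y * exp ((y + r) / 2)) \<partial>lborel) =
      (\<integral>\<^sup>+z. ennreal (indicator {..r} (r + (-1) * z) * exp (((r + (-1) * z) + r) / 2)) \<partial>lborel)"
    by (subst nn_integral_real_affine[of _ "-1" r]) auto
  also have "\<dots> = (\<integral>\<^sup>+z. ennreal (exp (r - z / 2)) * indicator {0..} z \<partial>lborel)"
    by (intro nn_integral_cong) (auto simp: indicator_def diff_divide_distrib)
  also have "\<dots> = ennreal (0 - (- 2 * exp (r - 0 / 2)))"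
  proof (rule nn_integral_FTC_atLeast)
    have "filterlim (\<lambda>z::real. 1 / 2 * z) at_top at_top"
      by (rule filterlim_tendsto_pos_mult_at_top[OF tendsto_const _ filterlim_ident]) simp
    then have "filterlim (\<lambda>z::real. - (1 / 2 * z)) at_bot at_top"
      by (rule filterlim_compose[OF filterlim_uminus_at_bot_at_top])
    then have "((\<lambda>z. - 2 * exp r * exp (- (1 / 2 * z))) \<longlongrightarrow> - 2 * exp r * 0) at_top"
      by (intro tendsto_mult tendsto_const filterlim_compose[OF exp_at_bot])
    then show "((\<lambda>z. - 2 * exp (r - z / 2)) \<longlongrightarrow> 0) at_top"
      by (simp add: mult.assoc mult_exp_exp)
  qed (auto intro!: derivative_eq_intros)
  finally show ?thesis by simp
qed

lemma nn_integral_gaussian_scaled: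
  assumes "0 < r"
  shows "(\<integral>\<^sup>+y. ennreal (exp (- (y\<^sup>2 / (4 * r)))) \<partial>lborel) = ennreal (sqrt (4 * pi * r))"
proof -
  define \<sigma> where "\<sigma> = sqrt (2 * r)"
  have \<sigma>: "0 < \<sigma>" "\<sigma>\<^sup>2 = 2 * r" using assms by (auto simp: \<sigma>_def)
  have eq: "exp (- (y\<^sup>2 / (4 * r))) = sqrt (4 * pi * r) * normal_density 0 \<sigma> y" for y
    using assms by (simp add: normal_density_def \<sigma> mult_ac)
  have "(\<integral>\<^sup>+y. ennreal (exp (- (y\<^sup>2 / (4 * r)))) \<partial>lborel) =
      (\<integral>\<^sup>+y. ennreal (sqrt (4 * pi * r)) * ennreal (normal_density 0 \<sigma> y) \<partial>lborel)"
    using assms by (simp add: eq ennreal_mult)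
  also have "\<dots> = ennreal (sqrt (4 * pi * r)) * (\<integral>\<^sup>+y. ennreal (normal_density 0 \<sigma> y) \<partial>lborel)"
    by (rule nn_integral_cmult) auto
  also have "(\<integral>\<^sup>+y. ennreal (normal_density 0 \<sigma> y) \<partial>lborel) = 1"
    using \<sigma> by (subst nn_integral_eq_integral) auto
  finally show ?thesis by simp
qed

text \<open>
  On the ball, \<open>|x'|\<^sup>2 \<le> 2 r (r - x \<bullet> e)\<close> for the component \<open>x'\<close> of \<open>x\<close> orthogonal to \<open>e\<close>. Half of
  the decay of \<open>exp (x \<bullet> e - r)\<close> away from the pole is therefore worth a Gaussian of variance \<open>2 r\<close> in
  \<open>x'\<close>, and the other half is integrable along \<open>e\<close>; the majorant is a product over the
  coordinates. This is the source of the factor \<open>r powr ((N - 1) / 2)\<close>.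
\<close>
lemma exp_inner_ball_bound:
  fixes e :: "'a::euclidean_space"
  assumes e: "e \<in> Basis" and r: "0 < r"
  shows "integrable lebesgue (\<lambda>x. indicator (cball 0 r) x * exp (x \<bullet> e))"
    and "(LINT x|lebesgue. indicator (cball 0 r) x * exp (x \<bullet> e))
      \<le> 2 * exp r * (4 * pi * r) powr ((real DIM('a) - 1) / 2)"
proof -
  define B where "B = 2 * exp r * sqrt (4 * pi * r) ^ (DIM('a) - 1)"
  define h :: "'a \<Rightarrow> real \<Rightarrow> real" where
    "h b y = (if b = e then indicator {..r} y * exp ((y + r) / 2) else exp (- (y\<^sup>2 / (4 * r))))" for b y
  have h[measurable]: "h b \<in> borel_measurable borel" for b
    unfolding h_def by (cases "b = e") auto
  have hpos: "0 \<le> h b y" for b y by (simp add: h_def)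
  have le: "indicator (cball 0 r) x * exp (x \<bullet> e) \<le> (\<Prod>b\<in>Basis. h b (x \<bullet> b))" for x :: 'a
  proof (cases "norm x \<le> r")
    case True
    define y where "y = x \<bullet> e"
    define s where "s = (\<Sum>b\<in>Basis - {e}. (x \<bullet> b)\<^sup>2)"
    have "\<bar>y\<bar> \<le> r" using Basis_le_norm[OF e, of x] True by (simp add: y_def)
    have "(norm x)\<^sup>2 = y\<^sup>2 + s"
      unfolding power2_norm_eq_inner euclidean_inner[of x x] sum.remove[OF finite_Basis e]
      by (simp add: y_def s_def power2_eq_square)
    moreover have "(norm x)\<^sup>2 \<le> r\<^sup>2" using True by (intro power_mono) auto
    ultimately have "s \<le> (r - y) * (r + y)" by (simp add: power2_eq_square algebra_simps)
    also have "\<dots> \<le> (r - y) * (2 * r)" using \<open>\<bar>y\<bar> \<le> r\<close> by (intro mult_left_mono) auto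
    finally have "s / (4 * r) \<le> (r - y) / 2" using r by (simp add: field_simps)
    then have "exp y \<le> exp ((y + r) / 2 + - (s / (4 * r)))"
      by (simp add: field_simps)
    also have "\<dots> = exp ((y + r) / 2) * exp (\<Sum>b\<in>Basis - {e}. - ((x \<bullet> b)\<^sup>2 / (4 * r)))"
      by (simp only: exp_add s_def sum_divide_distrib sum_negf)
    also have "\<dots> = h e (x \<bullet> e) * (\<Prod>b\<in>Basis - {e}. h b (x \<bullet> b))"
      using \<open>\<bar>y\<bar> \<le> r\<close> by (simp add: h_def y_def exp_sum)
    also have "\<dots> = (\<Prod>b\<in>Basis. h b (x \<bullet> b))"
      using e by (simp add: prod.remove[of Basis e])
    finally show ?thesis using True by (simp add: y_def)
  next
    case False
    then show ?thesis by (simp add: prod_nonneg hpos)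
  qed
  have "(\<integral>\<^sup>+x. ennreal (indicator (cball 0 r) x * exp (x \<bullet> e)) \<partial>lborel) \<le>
      (\<integral>\<^sup>+x. (\<Prod>b\<in>Basis. ennreal (h b (x \<bullet> b))) \<partial>lborel)"
    using le by (intro nn_integral_mono) (simp add: prod_ennreal hpos ennreal_leI)
  also have "\<dots> = (\<Prod>b\<in>Basis. (\<integral>\<^sup>+y. ennreal (h b y) \<partial>lborel))"
    by (rule nn_integral_lborel_prod) (auto simp: hpos)
  also have "\<dots> = (\<integral>\<^sup>+y. ennreal (h e y) \<partial>lborel) * (\<Prod>b\<in>Basis - {e}. (\<integral>\<^sup>+y. ennreal (h b y) \<partial>lborel))"
    using e by (simp add: prod.remove[of Basis e])
  also have "\<dots> = ennreal (2 * exp r) * (\<Prod>b\<in>Basis - {e}. ennreal (sqrt (4 * pi * r)))"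
    by (intro arg_cong2[where f="(*)"] prod.cong refl)
      (simp_all add: h_def nn_integral_exp_halfline nn_integral_gaussian_scaled r)
  also have "\<dots> = ennreal B"
    using e r by (simp add: B_def card_Diff_singleton ennreal_mult ennreal_power)
  finally have nn: "(\<integral>\<^sup>+x. ennreal (indicator (cball 0 r) x * exp (x \<bullet> e)) \<partial>lborel) \<le> ennreal B" .
  have m: "(\<lambda>x. indicator (cball 0 r) x * exp (x \<bullet> e)) \<in> borel_measurable lborel"
    by (auto intro!: borel_measurable_times borel_measurable_indicator)
  have int: "integrable lborel (\<lambda>x. indicator (cball 0 r) x * exp (x \<bullet> e))"
    using nn m by (intro integrableI_nonneg) (auto simp: top_unique less_top[symmetric])
  then show "integrable lebesgue (\<lambda>x. indicator (cball 0 r) x * exp (x \<bullet> e))"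
    using m by (simp add: integrable_completion)
  have "0 \<le> B" using r by (simp add: B_def)
  then have "(LINT x|lborel. indicator (cball 0 r) x * exp (x \<bullet> e)) \<le> B"
    using nn by (subst (asm) nn_integral_eq_integral[OF int]) auto
  also have "B = 2 * exp r * (4 * pi * r) powr ((real DIM('a) - 1) / 2)"
  proof -
    have "real (DIM('a) - 1) = real DIM('a) - 1" by (simp add: of_nat_diff Suc_leI)
    then have "sqrt (4 * pi * r) ^ (DIM('a) - 1) = (4 * pi * r) powr ((real DIM('a) - 1) / 2)"
      using r by (simp add: powr_half_sqrt[symmetric] powr_powr powr_realpow[symmetric])
    then show ?thesis by (simp add: B_def)
  qed
  finally show "(LINT x|lebesgue. indicator (cball 0 r) x * exp (x \<bullet> e))
      \<le> 2 * exp r * (4 * pi * r) powr ((real DIM('a) - 1) / 2)"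
    using m by (simp add: integral_completion)
qed

text \<open>
  Hoelder's inequality for the weight \<open>\<phi>\<close> on \<open>S\<close>, up to the harmless factor \<open>(1 / 2) powr p\<close>. It
  follows from the pointwise bound \<open>|w| \<le> l + l powr (1 - p) |w|\<^sup>p\<close> with the level \<open>l\<close> chosen so
  that the first term contributes half of the left-hand integral.
\<close>
lemma reverse_Hoelder:
  fixes w \<phi> :: "'a \<Rightarrow> real"
  assumes p: "1 < p" and \<phi>: "\<And>x. 0 \<le> \<phi> x"
    and int: "integrable M (\<lambda>x. w x * \<phi> x)" "integrable M (\<lambda>x. \<bar>w x\<bar> powr p * \<phi> x)"
    and S: "integrable M (\<lambda>x. indicator S x * \<phi> x)" "(LINT x|M. indicator S x * \<phi> x) \<le> m" and m: "0 < m"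
    and w: "AE x in M. x \<notin> S \<longrightarrow> w x = 0"
  shows "(\<bar>LINT x|M. w x * \<phi> x\<bar> / 2) powr p * m powr (1 - p) \<le> (LINT x|M. \<bar>w x\<bar> powr p * \<phi> x)"
proof -
  define a where "a = \<bar>LINT x|M. w x * \<phi> x\<bar>"
  define F where "F = (LINT x|M. \<bar>w x\<bar> powr p * \<phi> x)"
  have "0 \<le> F" unfolding F_def using \<phi> by (intro Bochner_Integration.integral_nonneg) auto
  show ?thesis
  proof (cases "a = 0")
    case True
    then show ?thesis using \<open>0 \<le> F\<close> p by (simp add: a_def F_def)
  next
    case False
    then have a: "0 < a" by (simp add: a_def)
    \<comment> \<open>The level at which \<open>l m\<close> is half of \<open>a\<close>.\<close>
    define l where "l = a / 2 / m"
    have l: "0 < l" using a m by (simp add: l_def)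
    have pw: "\<bar>z\<bar> \<le> l + l powr (1 - p) * \<bar>z\<bar> powr p" for z :: real
    proof (cases "\<bar>z\<bar> \<le> l")
      case True
      then show ?thesis by (intro order_trans[OF True]) simp
    next
      case False
      then have "\<bar>z\<bar> = \<bar>z\<bar> powr (1 - p) * \<bar>z\<bar> powr p" using l by (simp flip: powr_add)
      also have "\<dots> \<le> l powr (1 - p) * \<bar>z\<bar> powr p"
        using False l p by (intro mult_right_mono powr_mono2') auto
      finally show ?thesis using l by linarith
    qed
    have "a \<le> (LINT x|M. \<bar>w x * \<phi> x\<bar>)"
      unfolding a_def by (rule integral_abs_bound)
    also have "\<dots> \<le> (LINT x|M. l * (indicator S x * \<phi> x) + l powr (1 - p) * (\<bar>w x\<bar> powr p * \<phi> x))"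
    proof (rule integral_mono_AE)
      show "AE x in M. \<bar>w x * \<phi> x\<bar> \<le> l * (indicator S x * \<phi> x) + l powr (1 - p) * (\<bar>w x\<bar> powr p * \<phi> x)"
        using w
      proof eventually_elim
        case (elim x)
        show ?case
        proof (cases "x \<in> S")
          case True
          then show ?thesis
            using mult_right_mono[OF pw[of "w x"] \<phi>[of x]] \<phi>[of x] by (simp add: abs_mult algebra_simps)
        qed (use elim p in simp)
      qed
    qed (use int S in auto)
    also have "\<dots> = l * (LINT x|M. indicator S x * \<phi> x) + l powr (1 - p) * F"
      using int S by (simp add: F_def)
    also have "\<dots> \<le> l * m + l powr (1 - p) * F"
      using S(2) l by simp
    also have "l * m = a / 2" using m by (simp add: l_def)
    finally have "a / 2 \<le> l powr (1 - p) * F" by simp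
    then have "l powr (p - 1) * (a / 2) \<le> l powr (p - 1) * (l powr (1 - p) * F)"
      by (intro mult_left_mono) auto
    also have "\<dots> = F" using l by (simp add: mult.assoc[symmetric] powr_add[symmetric])
    also have "l powr (p - 1) * (a / 2) = (a / 2) powr p * m powr (1 - p)"
    proof -
      have "l powr (p - 1) = (a / 2) powr (p - 1) / m powr (p - 1)"
        unfolding l_def using a m by (intro powr_divide)
      also have "\<dots> = (a / 2) powr p / (a / 2) * m powr (1 - p)"
        using a m powr_minus_divide[of m "p - 1"] by (simp add: powr_diff)
      finally show ?thesis using a by simp
    qed
    finally show ?thesis by (simp add: a_def F_def)
  qed
qed

section \<open>The cut-off exponential as a test function\<close>

lemma test_functions_UNIV: "test_functions UNIV = {\<phi>. smooth \<phi> \<and> (\<exists>K. compact K \<and> (\<forall>x. x \<notin> K \<longrightarrow> \<phi> x = 0))}"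
  by (auto simp: test_functions_def)

lemma frechet_derivative_eq_on_open:
  assumes "open S" "x \<in> S" "\<And>y. y \<in> S \<Longrightarrow> f y = g y" "(g has_derivative g') (at x)"
  shows "frechet_derivative f (at x) = g'"
proof -
  have "(f has_derivative g') (at x)"
    by (rule has_derivative_transform_within_open[OF assms(4,1,2)]) (use assms(3) in auto)
  then show ?thesis using frechet_derivative_at by metis
qed

lemma test_functions_partial:
  assumes "\<phi> \<in> test_functions UNIV" "i \<in> Basis"
  shows "(\<lambda>x. frechet_derivative \<phi> (at x) i) \<in> test_functions UNIV"
proof -
  obtain K where K: "compact K" "\<And>x. x \<notin> K \<Longrightarrow> \<phi> x = 0" and s: "smooth \<phi>"
    using assms(1) by (auto simp: test_functions_UNIV)
  have "frechet_derivative \<phi> (at x) i = 0" if "x \<notin> K" for x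
    using frechet_derivative_eq_on_open[of "- K" x \<phi> "\<lambda>_. 0" "\<lambda>_. 0"] K that compact_imp_closed[OF K(1)]
    by (simp add: open_Compl)
  then show ?thesis
    using K(1) smooth_partial[OF s assms(2)] by (auto simp: test_functions_UNIV)
qed

lemma test_functions_L2:
  assumes "\<phi> \<in> test_functions UNIV"
  shows "\<phi> \<in> L2"
proof -
  obtain K where K: "compact K" "\<And>x. x \<notin> K \<Longrightarrow> \<phi> x = 0" and s: "smooth \<phi>"
    using assms by (auto simp: test_functions_UNIV)
  have c: "continuous_on UNIV \<phi>" by (rule smooth_continuous[OF s])
  then have m: "\<phi> \<in> borel_measurable lborel" by (simp add: borel_measurable_continuous_onI)
  have "integrable lborel (\<lambda>x. indicator K x *\<^sub>R (\<phi> x * \<phi> x))"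
    using K(1) continuous_on_subset[OF c] by (intro borel_integrable_compact continuous_on_mult) auto
  also have "(\<lambda>x. indicator K x *\<^sub>R (\<phi> x * \<phi> x)) = (\<lambda>x. \<phi> x * \<phi> x)"
    using K(2) by (auto simp: indicator_def fun_eq_iff)
  finally show ?thesis
    using m by (simp add: L2_real integrable_completion measurable_completion)
qed

text \<open>
  The weak gradient of \<open>u\<close> is tested against each partial derivative of \<open>\<phi>\<close>; the sum on the right is
  the Laplacian of \<open>\<phi>\<close>.
\<close>
lemma integral_weak_grad_test_function:
  fixes u :: "'a::euclidean_space \<Rightarrow> real"
  assumes u: "u \<in> H1" and \<phi>: "\<phi> \<in> test_functions UNIV"
  shows "(LINT x|lebesgue. weak_grad u x \<bullet> grad \<phi> x) =
    - (LINT x|lebesgue. u x * (\<Sum>i\<in>Basis. frechet_derivative (\<lambda>y. frechet_derivative \<phi> (at y) i) (at x) i))"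
proof -
  define G where "G = weak_grad u"
  have "\<exists>G. G \<in> L2 \<and> has_weak_gradient u G" using u by (auto simp: H1_def)
  then have G: "G \<in> L2" "has_weak_gradient u G"
    unfolding G_def weak_grad_def by (metis (mono_tags, lifting) someI_ex)+
  have uL2: "u \<in> L2" using u by (simp add: H1_def)
  have gradi: "grad \<psi> x \<bullet> i = frechet_derivative \<psi> (at x) i" if "i \<in> Basis" for \<psi> :: "'a \<Rightarrow> real" and x i
    using that by (simp add: grad_def inner_sum_left inner_Basis if_distrib cong: if_cong)
  define D where "D i x = frechet_derivative \<phi> (at x) i" for i x
  have D: "D i \<in> test_functions UNIV" if "i \<in> Basis" for i
    unfolding D_def[abs_def] using \<phi> that by (rule test_functions_partial)
  have GiL2: "(\<lambda>x. G x \<bullet> i) \<in> L2" if "i \<in> Basis" for i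
  proof -
    have mG: "G \<in> borel_measurable lebesgue" using G(1) by (simp add: L2_def)
    then have m: "(\<lambda>x. G x \<bullet> i) \<in> borel_measurable lebesgue" by (intro borel_measurable_inner) auto
    have "integrable lebesgue (\<lambda>x. (G x \<bullet> i) * (G x \<bullet> i))"
    proof (rule Bochner_Integration.integrable_bound)
      show "integrable lebesgue (\<lambda>x. (norm (G x))\<^sup>2)" using G(1) by (simp add: L2_def)
      show "(\<lambda>x. (G x \<bullet> i) * (G x \<bullet> i)) \<in> borel_measurable lebesgue"
        using m by (intro borel_measurable_times)
      show "AE x in lebesgue. norm ((G x \<bullet> i) * (G x \<bullet> i)) \<le> norm ((norm (G x))\<^sup>2)"
      proof (rule AE_I2)
        fix x
        have "(G x \<bullet> i)\<^sup>2 \<le> (norm (G x))\<^sup>2"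
          using Basis_le_norm[OF that, of "G x"] by (metis abs_le_square_iff abs_norm_cancel)
        then show "norm ((G x \<bullet> i) * (G x \<bullet> i)) \<le> norm ((norm (G x))\<^sup>2)"
          by (simp add: power2_eq_square)
      qed
    qed
    with m show ?thesis by (simp add: L2_real)
  qed
  have int: "integrable lebesgue (\<lambda>x. (G x \<bullet> i) * D i x)" if "i \<in> Basis" for i
    using that by (intro integrable_L2_mult GiL2 test_functions_L2 D)
  have int': "integrable lebesgue (\<lambda>x. u x * frechet_derivative (D i) (at x) i)" if "i \<in> Basis" for i
    using that by (intro integrable_L2_mult uL2 test_functions_L2 test_functions_partial D)
  have "(LINT x|lebesgue. G x \<bullet> grad \<phi> x) = (LINT x|lebesgue. (\<Sum>i\<in>Basis. (G x \<bullet> i) * D i x))"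
    by (intro Bochner_Integration.integral_cong refl, subst euclidean_inner)
      (simp add: gradi D_def)
  also have "\<dots> = (\<Sum>i\<in>Basis. LINT x|lebesgue. (G x \<bullet> i) * D i x)"
    using int by (rule Bochner_Integration.integral_sum)
  also have "\<dots> = (\<Sum>i\<in>Basis. - (LINT x|lebesgue. u x * frechet_derivative (D i) (at x) i))"
  proof (rule sum.cong[OF refl])
    fix i :: 'a assume i: "i \<in> Basis"
    have "(LINT x|lebesgue. u x * (grad (D i) x \<bullet> i)) = - (LINT x|lebesgue. (G x \<bullet> i) * D i x)"
      using G(2) D[OF i] i by (auto simp: has_weak_gradient_def)
    then show "(LINT x|lebesgue. (G x \<bullet> i) * D i x) = - (LINT x|lebesgue. u x * frechet_derivative (D i) (at x) i)"
      using i by (simp add: gradi)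
  qed
  also have "\<dots> = - (LINT x|lebesgue. (\<Sum>i\<in>Basis. u x * frechet_derivative (D i) (at x) i))"
    using int' by (simp add: Bochner_Integration.integral_sum sum_negf)
  finally show ?thesis
    by (simp add: G_def D_def[abs_def] sum_distrib_left)
qed

text \<open>
  The plane exponential, cut off smoothly between the radii \<open>\<rho>\<close> and \<open>sqrt (\<rho>\<^sup>2 + 1)\<close>. Using the
  squared norm avoids the singularity of the norm at the origin.
\<close>
definition cut_exp :: "real \<Rightarrow> 'a::euclidean_space \<Rightarrow> 'a \<Rightarrow> real" where
  "cut_exp \<rho> e x = smooth_step ((\<rho>\<^sup>2 + 1) + (-1) * (norm x)\<^sup>2) * exp (x \<bullet> e)"

lemma cut_exp_nonneg: "0 \<le> cut_exp \<rho> e x"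
  by (simp add: cut_exp_def smooth_step_nonneg)

lemma cut_exp_eq_exp: "norm x \<le> \<rho> \<Longrightarrow> cut_exp \<rho> e x = exp (x \<bullet> e)"
  using power_mono[of "norm x" \<rho> 2] by (simp add: cut_exp_def smooth_step_1)

lemma cut_exp_eq_0: "0 \<le> \<rho> \<Longrightarrow> \<rho> + 1 < norm x \<Longrightarrow> cut_exp \<rho> e x = 0"
  using power_mono[of "\<rho> + 1" "norm x" 2]
  by (simp add: cut_exp_def smooth_step_0 power2_eq_square algebra_simps)

text \<open>
  The linear map \<open>L\<close> allows for functions of space-time that depend on \<open>x\<close> only.
\<close>
lemma smooth_cut_exp_compose:
  assumes "bounded_linear L"
  shows "smooth (\<lambda>z. cut_exp \<rho> e (L z))"
  unfolding cut_exp_def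
  by (intro smooth_mult smooth_compose[OF smooth_smooth_step] smooth_compose[OF smooth_exp]
      smooth_add smooth_const smooth_norm_sq assms
      smooth_linear bounded_linear_compose[OF bounded_linear_inner_left assms])

lemma cut_exp_test_function:
  assumes "0 \<le> \<rho>"
  shows "cut_exp \<rho> e \<in> test_functions UNIV"
proof -
  have "smooth (cut_exp \<rho> e)"
    by (rule smooth_cut_exp_compose[OF bounded_linear_ident])
  then show ?thesis
    using cut_exp_eq_0[OF assms]
    by (auto simp: test_functions_UNIV not_le intro!: exI[of _ "cball 0 (\<rho> + 1)"])
qed

lemma cut_exp_laplacian:
  fixes e :: "'a::euclidean_space"
  assumes e: "e \<in> Basis" and x: "norm x < \<rho>"
  shows "(\<Sum>i\<in>Basis. frechet_derivative (\<lambda>y. frechet_derivative (cut_exp \<rho> e) (at y) i) (at x) i) = exp (x \<bullet> e)"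
proof -
  have d: "((\<lambda>y. c * exp (y \<bullet> e)) has_derivative (\<lambda>h. c * (h \<bullet> e) * exp (y \<bullet> e))) (at y)" for c y
    by (auto intro!: derivative_eq_intros)
  have 1: "frechet_derivative (cut_exp \<rho> e) (at y) i = (i \<bullet> e) * exp (y \<bullet> e)" if "y \<in> ball 0 \<rho>" for y i
    using frechet_derivative_eq_on_open[OF open_ball that _ d[of 1], of "cut_exp \<rho> e"] by (simp add: cut_exp_eq_exp)
  have 2: "frechet_derivative (\<lambda>y. frechet_derivative (cut_exp \<rho> e) (at y) i) (at x) i =
      (i \<bullet> e) * (i \<bullet> e) * exp (x \<bullet> e)" for i
    using frechet_derivative_eq_on_open[OF open_ball[of 0 \<rho>] _ 1[of _ i] d[of "i \<bullet> e" x]] x by simp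
  have "(\<Sum>i\<in>Basis. (i \<bullet> e) * (i \<bullet> e) * exp (x \<bullet> e)) = (\<Sum>i\<in>Basis. if i = e then exp (x \<bullet> e) else 0)"
    using e by (intro sum.cong) (auto simp: inner_Basis)
  then show ?thesis using e by (simp add: 2)
qed

section \<open>A damped differential inequality\<close>

text \<open>
  For each slope \<open>-\<delta>\<close> the set of points where \<open>Y\<close> lies on or above the line of this slope through
  \<open>(a, Y a)\<close> is compact, and by assumption its maximum can only be \<open>b\<close>.
\<close>
lemma increasing_if_lower_Dini_nonneg:
  fixes Y :: "real \<Rightarrow> real"
  assumes "a \<le> b" and cont: "continuous_on {a..b} Y"
    and dini: "\<And>t \<delta>. a \<le> t \<Longrightarrow> t < b \<Longrightarrow> 0 < \<delta> \<Longrightarrow> \<exists>s\<in>{t<..b}. Y s - Y t \<ge> - \<delta> * (s - t)"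
  shows "Y a \<le> Y b"
proof -
  have *: "Y a - \<delta> * (b - a) \<le> Y b" if "0 < \<delta>" for \<delta>
  proof -
    define S where "S = {t\<in>{a..b}. Y a \<le> Y t + \<delta> * (t - a)}"
    have "S = {a..b} \<inter> {t\<in>{a..b}. Y a \<le> Y t + \<delta> * (t - a)}"
      by (auto simp: S_def)
    moreover have "closed {t\<in>{a..b}. Y a \<le> Y t + \<delta> * (t - a)}"
      by (intro continuous_on_closed_Collect_le continuous_intros cont closed_atLeastAtMost)
    ultimately have "compact S" by (metis compact_Icc compact_Int_closed)
    moreover have "a \<in> S" using \<open>a \<le> b\<close> by (simp add: S_def)
    ultimately obtain m where m: "m \<in> S" "\<And>t. t \<in> S \<Longrightarrow> t \<le> m"
      using compact_attains_sup[of S] by blast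
    have "m = b"
    proof (rule ccontr)
      assume "m \<noteq> b"
      then have "a \<le> m" "m < b" using m(1) by (auto simp: S_def)
      then obtain s where s: "s \<in> {m<..b}" "Y s - Y m \<ge> - \<delta> * (s - m)"
        using dini \<open>0 < \<delta>\<close> by blast
      have "s \<in> S"
        using s m(1) by (auto simp: S_def algebra_simps)
      then show False using m(2) s(1) by fastforce
    qed
    then show ?thesis using m(1) by (simp add: S_def algebra_simps)
  qed
  have "((\<lambda>\<delta>. Y a - \<delta> * (b - a)) \<longlongrightarrow> Y a - 0 * (b - a)) (at_right 0)"
    by (intro tendsto_intros)
  then have "Y a - 0 * (b - a) \<le> Y b"
    by (rule tendsto_upperbound) (auto intro!: * eventually_mono[OF eventually_at_right_less])
  then show ?thesis by simp
qed

text \<open>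
  \<open>d\<close> is a lower bound for the lower right Dini derivative of \<open>Y\<close> at \<open>t\<close>.
\<close>
definition lower_rderiv :: "(real \<Rightarrow> real) \<Rightarrow> real \<Rightarrow> real \<Rightarrow> bool" where
  "lower_rderiv Y d t \<longleftrightarrow> (\<forall>\<delta>>0. \<forall>\<^sub>F s in at_right t. Y s - Y t \<ge> (d - \<delta>) * (s - t))"

lemma lower_rderiv_mono: "lower_rderiv Y d t \<Longrightarrow> d' \<le> d \<Longrightarrow> lower_rderiv Y d' t"
  unfolding lower_rderiv_def
proof (intro allI impI)
  fix \<delta> :: real assume "\<forall>\<delta>>0. \<forall>\<^sub>F s in at_right t. (d - \<delta>) * (s - t) \<le> Y s - Y t" "d' \<le> d" "0 < \<delta>"
  then have "\<forall>\<^sub>F s in at_right t. (d - \<delta>) * (s - t) \<le> Y s - Y t" by blast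
  then show "\<forall>\<^sub>F s in at_right t. (d' - \<delta>) * (s - t) \<le> Y s - Y t"
    using eventually_at_right_less[of t]
  proof eventually_elim
    case (elim s)
    then have "(d' - \<delta>) * (s - t) \<le> (d - \<delta>) * (s - t)"
      using \<open>d' \<le> d\<close> by (intro mult_right_mono) auto
    then show ?case using elim by linarith
  qed
qed

lemma lower_rderiv_DERIV:
  assumes "(Y has_real_derivative d) (at_right t)"
  shows "lower_rderiv Y d t"
  unfolding lower_rderiv_def
proof (intro allI impI)
  fix \<delta> :: real assume "0 < \<delta>"
  have "((\<lambda>s. (Y s - Y t) / (s - t)) \<longlongrightarrow> d) (at_right t)"
    using assms by (simp add: has_field_derivative_iff)
  then have "\<forall>\<^sub>F s in at_right t. d - \<delta> < (Y s - Y t) / (s - t)"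
    using \<open>0 < \<delta>\<close> by (intro order_tendstoD) auto
  then show "\<forall>\<^sub>F s in at_right t. (d - \<delta>) * (s - t) \<le> Y s - Y t"
    using eventually_at_right_less[of t]
    by eventually_elim (simp add: field_simps)
qed

lemma lower_rderiv_add:
  assumes "lower_rderiv Y d t" "lower_rderiv X e t"
  shows "lower_rderiv (\<lambda>s. Y s + X s) (d + e) t"
  unfolding lower_rderiv_def
proof (intro allI impI)
  fix \<delta> :: real assume "0 < \<delta>"
  then have "\<forall>\<^sub>F s in at_right t. (d - \<delta>/2) * (s - t) \<le> Y s - Y t"
    "\<forall>\<^sub>F s in at_right t. (e - \<delta>/2) * (s - t) \<le> X s - X t"
    using assms unfolding lower_rderiv_def by auto
  then show "\<forall>\<^sub>F s in at_right t. (d + e - \<delta>) * (s - t) \<le> (Y s + X s) - (Y t + X t)"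
  proof eventually_elim
    case (elim s)
    have "(d + e - \<delta>) * (s - t) = (d - \<delta>/2) * (s - t) + (e - \<delta>/2) * (s - t)"
      by (simp add: field_simps)
    then show ?case using elim by linarith
  qed
qed

text \<open>
  Multiplication by a positive differentiable function preserves the inequality. This is what
  integrating factors require.
\<close>
lemma lower_rderiv_mult:
  assumes Y: "lower_rderiv Y d t" and E: "(E has_real_derivative e) (at_right t)"
    and pos: "\<And>s. t \<le> s \<Longrightarrow> 0 < E s"
  shows "lower_rderiv (\<lambda>s. E s * Y s) (e * Y t + E t * d) t"
  unfolding lower_rderiv_def
proof (intro allI impI)
  fix \<delta> :: real assume "0 < \<delta>"
  \<comment> \<open>The error \<open>\<delta>\<close> is split equally between the two limits and the Dini bound for \<open>Y\<close>.\<close>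
  define \<eta> where "\<eta> = \<delta> / (3 * E t)"
  have "0 < E t" using pos by simp
  then have "0 < \<eta>" "E t * \<eta> = \<delta> / 3" using \<open>0 < \<delta>\<close> by (auto simp: \<eta>_def)
  have "((\<lambda>s. (E s - E t) / (s - t) * Y t) \<longlongrightarrow> e * Y t) (at_right t)"
    using E by (intro tendsto_intros) (simp add: has_field_derivative_iff)
  then have 1: "\<forall>\<^sub>F s in at_right t. e * Y t - \<delta> / 3 < (E s - E t) / (s - t) * Y t"
    using \<open>0 < \<delta>\<close> by (intro order_tendstoD) auto
  have "(E \<longlongrightarrow> E t) (at_right t)"
    using E DERIV_continuous continuous_within by blast
  then have "((\<lambda>s. E s * (d - \<eta>)) \<longlongrightarrow> E t * (d - \<eta>)) (at_right t)"
    by (intro tendsto_intros)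
  then have 2: "\<forall>\<^sub>F s in at_right t. E t * (d - \<eta>) - \<delta> / 3 < E s * (d - \<eta>)"
    using \<open>0 < \<delta>\<close> by (intro order_tendstoD) auto
  have 3: "\<forall>\<^sub>F s in at_right t. (d - \<eta>) * (s - t) \<le> Y s - Y t"
    using Y \<open>0 < \<eta>\<close> unfolding lower_rderiv_def by auto
  show "\<forall>\<^sub>F s in at_right t. (e * Y t + E t * d - \<delta>) * (s - t) \<le> E s * Y s - E t * Y t"
    using 1 2 3 eventually_at_right_less[of t]
  proof eventually_elim
    case (elim s)
    have "(e * Y t - \<delta> / 3) * (s - t) \<le> (E s - E t) * Y t"
      using elim(1,4) by (simp add: field_simps)
    moreover have "(E t * (d - \<eta>) - \<delta> / 3) * (s - t) \<le> E s * (d - \<eta>) * (s - t)"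
      using elim(2,4) by (intro mult_right_mono) auto
    moreover have "E s * ((d - \<eta>) * (s - t)) \<le> E s * (Y s - Y t)"
      using elim(3,4) pos by (intro mult_left_mono) (auto simp: less_imp_le)
    moreover have "(e * Y t + E t * d - \<delta>) * (s - t) =
        (e * Y t - \<delta> / 3) * (s - t) + (E t * (d - \<eta>) - \<delta> / 3) * (s - t)"
      by (simp add: \<open>E t * \<eta> = \<delta> / 3\<close> distrib_left[symmetric] distrib_right[symmetric] right_diff_distrib)
        (simp add: field_simps)
    moreover have "E s * Y s - E t * Y t = (E s - E t) * Y t + E s * (Y s - Y t)"
      by (simp add: algebra_simps)
    ultimately show ?case by (simp only: mult.assoc)
  qed
qed

lemma lower_rderiv_nonneg_imp_le:
  assumes "a \<le> b" "continuous_on {a..b} Y" "\<And>t. a \<le> t \<Longrightarrow> t < b \<Longrightarrow> lower_rderiv Y 0 t"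
  shows "Y a \<le> Y b"
proof (rule increasing_if_lower_Dini_nonneg[OF assms(1,2)])
  fix t \<delta> :: real assume "a \<le> t" "t < b" "0 < \<delta>"
  then have "\<forall>\<^sub>F s in at_right t. (0 - \<delta>) * (s - t) \<le> Y s - Y t"
    using assms(3) unfolding lower_rderiv_def by blast
  moreover have "\<forall>\<^sub>F s in at_right t. s \<in> {t<..b}"
    using \<open>t < b\<close> eventually_at_right[OF \<open>t < b\<close>] by (auto intro!: exI[of _ b])
  ultimately have "\<forall>\<^sub>F s in at_right t. s \<in> {t<..b} \<and> (0 - \<delta>) * (s - t) \<le> Y s - Y t"
    by eventually_elim auto
  then have "\<exists>s. s \<in> {t<..b} \<and> (0 - \<delta>) * (s - t) \<le> Y s - Y t"
    by (rule eventually_happens'[rotated]) simp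
  then show "\<exists>s\<in>{t<..b}. - \<delta> * (s - t) \<le> Y s - Y t" by auto
qed

lemma lower_rderiv_integral:
  assumes cont: "continuous_on {a..b} r"
    and low: "\<And>s t. a \<le> s \<Longrightarrow> s \<le> t \<Longrightarrow> t \<le> b \<Longrightarrow> Y t - Y s \<ge> integral {s..t} r"
    and t: "a \<le> t" "t < b"
  shows "lower_rderiv Y (r t) t"
  unfolding lower_rderiv_def
proof (intro allI impI)
  fix \<delta> :: real assume "0 < \<delta>"
  have "lower_rderiv (\<lambda>s. integral {t..s} r) (r t) t"
  proof (rule lower_rderiv_DERIV)
    have "((\<lambda>s. integral {t..s} r) has_real_derivative r t) (at t within {t..b})"
      using continuous_on_subset[OF cont] t
      by (intro integral_has_real_derivative) auto
    then show "((\<lambda>s. integral {t..s} r) has_real_derivative r t) (at_right t)"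
      using t by (simp add: at_within_Icc_at_right)
  qed
  then have "\<forall>\<^sub>F s in at_right t. (r t - \<delta>) * (s - t) \<le> integral {t..s} r - integral {t..t} r"
    using \<open>0 < \<delta>\<close> unfolding lower_rderiv_def by blast
  moreover have "\<forall>\<^sub>F s in at_right t. s \<in> {t<..b}"
    using \<open>t < b\<close> eventually_at_right[OF \<open>t < b\<close>] by (auto intro!: exI[of _ b])
  ultimately show "\<forall>\<^sub>F s in at_right t. (r t - \<delta>) * (s - t) \<le> Y s - Y t"
  proof eventually_elim
    case (elim s)
    then show ?case using low[of t s] t by auto
  qed
qed

text \<open>
  The left-hand side of \<open>low\<close> defines a continuously differentiable minorant \<open>Y\<close> of \<open>X\<close> with
  \<open>Y' = X\<^sup>p w \<ge> Y\<^sup>p w\<close>, for which the equation can be separated: \<open>(- Y powr (1 - p))' \<ge> (p - 1) w\<close>,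
  while \<open>- Y powr (1 - p)\<close> is negative and starts at \<open>- X\<^sub>0 powr (1 - p)\<close>.
\<close>
lemma superlinear_integral_inequality:
  fixes X w :: "real \<Rightarrow> real"
  assumes "0 \<le> \<tau>" "1 < p" "0 < X\<^sub>0" and X: "continuous_on {0..\<tau>} X" and w: "continuous_on {0..\<tau>} w"
    and w0: "\<And>t. t \<in> {0..\<tau>} \<Longrightarrow> 0 \<le> w t"
    and Xpos: "\<And>t. t \<in> {0..\<tau>} \<Longrightarrow> 0 \<le> X t"
    and low: "\<And>t. t \<in> {0..\<tau>} \<Longrightarrow> X\<^sub>0 + integral {0..t} (\<lambda>s. X s powr p * w s) \<le> X t"
  shows "(p - 1) * integral {0..\<tau>} w \<le> X\<^sub>0 powr (1 - p)"
proof -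
  define r where "r = (\<lambda>s. X s powr p * w s)"
  define Y where "Y t = X\<^sub>0 + integral {0..t} r" for t
  have contr: "continuous_on {0..\<tau>} r"
    unfolding r_def using X w Xpos \<open>1 < p\<close> by (intro continuous_intros continuous_on_powr') auto
  have dY: "(Y has_real_derivative r t) (at t within {0..\<tau>})" if "t \<in> {0..\<tau>}" for t
    unfolding Y_def using integral_has_real_derivative[OF contr that]
    by (auto intro!: derivative_eq_intros)
  have Y0: "X\<^sub>0 \<le> Y t" if "t \<in> {0..\<tau>}" for t
  proof -
    have "0 \<le> integral {0..t} r"
      using that continuous_on_subset[OF contr, of "{0..t}"] w0
      by (intro integral_nonneg integrable_continuous_real) (auto simp: r_def)
    then show ?thesis by (simp add: Y_def)
  qed
  have YX: "Y t \<le> X t" if "t \<in> {0..\<tau>}" for t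
    using low[OF that] by (simp add: Y_def r_def)
  define D where "D t = - (Y t powr (1 - p))" for t
  have dD: "(D has_vector_derivative (p - 1) * (Y t powr (- p) * r t)) (at t within {0..\<tau>})"
    if "t \<in> {0..\<tau>}" for t
    unfolding D_def has_real_derivative_iff_has_vector_derivative[symmetric]
    using Y0[OF that] \<open>0 < X\<^sub>0\<close> dY[OF that]
    by (auto intro!: derivative_eq_intros simp: algebra_simps)
  have int: "((\<lambda>t. (p - 1) * (Y t powr (- p) * r t)) has_integral D \<tau> - D 0) {0..\<tau>}"
    by (rule fundamental_theorem_of_calculus[OF \<open>0 \<le> \<tau>\<close> dD])
  have "((\<lambda>t. (p - 1) * w t) has_integral (p - 1) * integral {0..\<tau>} w) {0..\<tau>}"
    by (intro has_integral_mult_right integrable_integral integrable_continuous_real w)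
  then have "(p - 1) * integral {0..\<tau>} w \<le> D \<tau> - D 0"
  proof (rule has_integral_le[OF _ int])
    fix t assume t: "t \<in> {0..\<tau>}"
    have "0 < Y t" using Y0[OF t] \<open>0 < X\<^sub>0\<close> by linarith
    then have "1 = Y t powr (- p) * Y t powr p" by (simp flip: powr_add)
    also have "\<dots> \<le> Y t powr (- p) * X t powr p"
      using \<open>0 < Y t\<close> YX[OF t] \<open>1 < p\<close> by (intro mult_left_mono powr_mono2) auto
    finally have "1 * w t \<le> Y t powr (- p) * X t powr p * w t"
      using w0[OF t] by (intro mult_right_mono) auto
    then show "(p - 1) * w t \<le> (p - 1) * (Y t powr (- p) * r t)"
      using \<open>1 < p\<close> by (intro mult_left_mono) (auto simp: r_def mult.assoc)
  qed
  also have "D \<tau> - D 0 \<le> X\<^sub>0 powr (1 - p)"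
    by (simp add: D_def Y_def)
  finally show ?thesis .
qed

text \<open>
  The inequality \<open>P' \<ge> Q - \<mu> / (1 + t) P + \<kappa> |P|\<^sup>p exp (-(p - 1) t) (1 + t) powr (-d (p - 1))\<close> with
  \<open>Q' = P\<close>, in integrated form. The auxiliary constant \<open>c\<close> is a lower bound for the ratio \<open>P / Q\<close>
  that the flow preserves.
\<close>
locale damped_ode =
  fixes \<mu> p \<kappa> d \<tau> c :: real and P Q :: "real \<Rightarrow> real"
  assumes \<mu>: "0 < \<mu>" and p: "1 < p" and \<kappa>: "0 < \<kappa>" and \<tau>: "0 \<le> \<tau>"
    and c: "0 < c" "c * (c + \<mu>) \<le> 1"
    and contP: "continuous_on {0..\<tau>} P"
    and derQ: "\<And>t. t \<in> {0..\<tau>} \<Longrightarrow> (Q has_real_derivative P t) (at t within {0..\<tau>})"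
    and low: "\<And>s t. 0 \<le> s \<Longrightarrow> s \<le> t \<Longrightarrow> t \<le> \<tau> \<Longrightarrow>
      P t - P s \<ge> integral {s..t} (\<lambda>r. Q r - \<mu> / (1 + r) * P r
        + \<kappa> * \<bar>P r\<bar> powr p * exp (- (p - 1) * r) * (1 + r) powr (- d * (p - 1)))"
    and Q0: "0 < Q 0" and P0: "c * Q 0 \<le> P 0"
begin

definition source :: "real \<Rightarrow> real" where
  "source r = \<kappa> * \<bar>P r\<bar> powr p * exp (- (p - 1) * r) * (1 + r) powr (- d * (p - 1))"

lemma source_nonneg: "0 \<le> source r"
  using \<kappa> by (simp add: source_def)

lemma contQ: "continuous_on {0..\<tau>} Q"
  using derQ by (rule DERIV_continuous_on)

lemma cont_source: "continuous_on {0..\<tau>} source"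
  unfolding source_def using p contP by (intro continuous_intros continuous_on_powr') auto

lemma derQ_right:
  assumes "0 \<le> t" "t < \<tau>"
  shows "(Q has_real_derivative P t) (at_right t)"
proof -
  have "(Q has_real_derivative P t) (at t within {t..\<tau>})"
    by (rule DERIV_subset[OF derQ]) (use assms in auto)
  then show ?thesis using assms by (simp add: at_within_Icc_at_right)
qed

lemma lower_rderiv_P:
  assumes "0 \<le> t" "t < \<tau>"
  shows "lower_rderiv P (Q t - \<mu> / (1 + t) * P t + source t) t"
proof (rule lower_rderiv_integral[of 0 \<tau> "\<lambda>t. Q t - \<mu> / (1 + t) * P t + source t"])
  show "continuous_on {0..\<tau>} (\<lambda>t. Q t - \<mu> / (1 + t) * P t + source t)"
    by (intro continuous_intros contQ contP cont_source) auto
  show "integral {s..t} (\<lambda>t. Q t - \<mu> / (1 + t) * P t + source t) \<le> P t - P s"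
    if "0 \<le> s" "s \<le> t" "t \<le> \<tau>" for s t
    using low[OF that] by (simp add: source_def)
qed (use assms in auto)

text \<open>
  The integrating factor \<open>E s = exp (c s) (1 + s) powr \<mu>\<close> makes the derivative of \<open>E (P - c Q)\<close> at
  least \<open>E (1 - c (c + \<mu> / (1 + s))) Q\<close>, which is nonnegative because \<open>c (c + \<mu>) \<le> 1\<close>.
\<close>
lemma P_ge_if_Q_nonneg:
  assumes "t \<le> \<tau>" "0 \<le> t" and Q: "\<And>s. 0 \<le> s \<Longrightarrow> s < t \<Longrightarrow> 0 \<le> Q s"
  shows "c * Q t \<le> P t"
proof -
  define E where "E s = exp (c * s + \<mu> * ln (1 + s))" for s
  define Y where "Y s = E s * (P s + - c * Q s)" for s
  have "Y 0 \<le> Y t"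
  proof (rule lower_rderiv_nonneg_imp_le[where Y=Y])
    show "continuous_on {0..t} Y"
      unfolding Y_def E_def
      by (intro continuous_intros continuous_on_subset[OF contP] continuous_on_subset[OF contQ])
        (use assms in auto)
    fix s assume s: "0 \<le> s" "s < t"
    have E: "(E has_real_derivative (c + \<mu> / (1 + s)) * E s) (at_right s)"
      unfolding E_def using s
      by (auto intro!: derivative_eq_intros)
    have "lower_rderiv (\<lambda>s. P s + - c * Q s) ((Q s - \<mu> / (1 + s) * P s + source s) + - c * P s) s"
      using s assms derQ_right[of s]
      by (intro lower_rderiv_add lower_rderiv_P lower_rderiv_DERIV)
        (auto intro!: derivative_eq_intros)
    from lower_rderiv_mult[OF this E] have "lower_rderiv Y ((c + \<mu> / (1 + s)) * E s * (P s + - c * Q s)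
        + E s * ((Q s - \<mu> / (1 + s) * P s + source s) + - c * P s)) s"
      by (simp add: Y_def[abs_def] E_def)
    then show "lower_rderiv Y 0 s"
    proof (rule lower_rderiv_mono)
      have "c * (c + \<mu> / (1 + s)) \<le> c * (c + \<mu>)"
        using s \<mu> c by (intro mult_left_mono add_left_mono) (auto simp: field_simps)
      then have "c * (c + \<mu> / (1 + s)) \<le> 1" using c by linarith
      then have "0 \<le> (1 - c * (c + \<mu> / (1 + s))) * Q s"
        using Q[OF s] by (intro mult_nonneg_nonneg) auto
      then have "0 \<le> E s * ((1 - c * (c + \<mu> / (1 + s))) * Q s + source s)"
        using source_nonneg[of s] by (intro mult_nonneg_nonneg) (auto simp: E_def)
      moreover have "(c + m) * E s * (P s + - c * Q s) + E s * ((Q s - m * P s + source s) + - c * P s) =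
          E s * ((1 - c * (c + m)) * Q s + source s)" for m
        by (simp add: algebra_simps)
      ultimately show "0 \<le> (c + \<mu> / (1 + s)) * E s * (P s + - c * Q s)
        + E s * ((Q s - \<mu> / (1 + s) * P s + source s) + - c * P s)"
        by (simp only:)
    qed
  qed fact
  moreover have "0 \<le> Y 0" using P0 by (simp add: Y_def E_def)
  ultimately have "0 \<le> E t * (P t + - c * Q t)" by (simp add: Y_def)
  moreover have "0 < E t" using assms by (simp add: E_def)
  ultimately show ?thesis by (simp add: zero_le_mult_iff)
qed

text \<open>
  Up to a first zero of \<open>Q\<close> the preceding lemma gives \<open>Q' = P \<ge> c Q \<ge> 0\<close>, so \<open>Q\<close> could not have decreased
  to zero.
\<close>
lemma Q_pos:
  assumes "t \<in> {0..\<tau>}"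
  shows "0 < Q t"
proof (rule ccontr)
  assume neg: "\<not> 0 < Q t"
  define S where "S = {s\<in>{0..t}. Q s \<le> 0}"
  have "closed S"
    unfolding S_def using assms
    by (intro continuous_on_closed_Collect_le continuous_on_subset[OF contQ] continuous_intros) auto
  moreover have "bounded S" by (rule bounded_subset[of "{0..t}"]) (auto simp: S_def)
  moreover have "t \<in> S" using neg assms by (simp add: S_def)
  ultimately obtain m where m: "m \<in> S" "\<And>s. s \<in> S \<Longrightarrow> m \<le> s"
    using compact_attains_inf[of S] compact_eq_bounded_closed by blast
  have m': "0 \<le> m" "m \<le> \<tau>" "Q m \<le> 0" using m(1) assms by (auto simp: S_def)
  have pos: "0 < Q s" if "0 \<le> s" "s < m" for s
    using m(2)[of s] m(1) that by (fastforce simp: S_def)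
  have "Q 0 \<le> Q m"
  proof (rule lower_rderiv_nonneg_imp_le[where Y=Q, OF m'(1)])
    show "continuous_on {0..m} Q"
      using m' by (intro continuous_on_subset[OF contQ]) auto
    fix s assume s: "0 \<le> s" "s < m"
    have "0 \<le> Q r" if "0 \<le> r" "r < s" for r
      using pos[of r] that s by simp
    then have "c * Q s \<le> P s" using s m' by (intro P_ge_if_Q_nonneg) auto
    moreover have "0 < c * Q s" using pos[OF s] c by simp
    ultimately show "lower_rderiv Q 0 s"
      using s m' by (intro lower_rderiv_mono[OF lower_rderiv_DERIV[OF derQ_right]]) auto
  qed
  then show False using Q0 m'(3) by linarith
qed


text \<open>
  The weight \<open>W\<close> is the reciprocal of the growth \<open>e\<^sup>t (1 + t) powr (-\<mu> / 2)\<close> expected from the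
  linear equation, corrected by the bounded factor \<open>exp (-\<mu> / (2 (1 + t)))\<close>. The correction adds
  \<open>\<mu> / (2 (1 + t)\<^sup>2)\<close> to the logarithmic derivative of \<open>W\<close>, just enough to make the
  linear terms in the derivative of \<open>X = W (P + b Q)\<close> nonnegative for every \<open>\<mu> > 0\<close>.
  Since \<open>X\<close> and \<open>W P\<close> are comparable, the nonlinear term becomes \<open>X\<^sup>p\<close> times a power of \<open>1 + t\<close>.
\<close>
lemma damped_ode_integral_bound:
  "(p - 1) * integral {0..\<tau>} (\<lambda>t. \<kappa> * (c / (c + 1 + \<mu> / 2)) powr p * (1 + t) powr (- (d + \<mu> / 2) * (p - 1)))
    \<le> (exp (- \<mu> / 2) * P 0) powr (1 - p)"
proof -
  define k where "k = c / (c + 1 + \<mu> / 2)"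
  define w where "w t = \<kappa> * k powr p * (1 + t) powr (- (d + \<mu> / 2) * (p - 1))" for t
  define W where "W t = exp (- t + \<mu> / 2 * ln (1 + t) - \<mu> / 2 / (1 + t))" for t
  define b where "b t = 1 + \<mu> / 2 / (1 + t)" for t
  define X where "X t = W t * (P t + b t * Q t)" for t
  have k: "0 < k" using c \<mu> by (auto simp: k_def field_simps add_pos_pos)
  have Ppos: "c * Q t \<le> P t" "0 < P t" if "t \<in> {0..\<tau>}" for t
  proof -
    show *: "c * Q t \<le> P t"
    proof (rule P_ge_if_Q_nonneg)
      fix s assume "0 \<le> s" "s < t"
      then show "0 \<le> Q s" using that Q_pos[of s] by simp
    qed (use that in auto)
    have "0 < c * Q t" using Q_pos[OF that] c by simp
    then show "0 < P t" using * by linarith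
  qed
  have Wpos: "0 < W t" for t by (simp add: W_def)
  have bpos: "1 \<le> b t" "b t \<le> 1 + \<mu> / 2" if "0 \<le> t" for t
    using that \<mu> by (auto simp: b_def field_simps)
  have ZP: "k * (P t + b t * Q t) \<le> P t" if "t \<in> {0..\<tau>}" for t
  proof -
    have "b t * (c * Q t) \<le> (1 + \<mu> / 2) * P t"
      using Ppos[OF that] bpos[of t] that c Q_pos[OF that] by (intro mult_mono) auto
    then have "c * (P t + b t * Q t) \<le> (c + 1 + \<mu> / 2) * P t"
      by (simp add: algebra_simps)
    moreover have "0 < c + 1 + \<mu> / 2" using c \<mu> by simp
    ultimately show ?thesis
      by (simp add: k_def pos_divide_le_eq mult.commute)
  qed
  have Zpos: "0 < P t + b t * Q t" if "t \<in> {0..\<tau>}" for t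
    using Ppos(2)[OF that] Q_pos[OF that] bpos[of t] that by (intro add_pos_pos mult_pos_pos) auto
  have Xpos: "0 < X t" if "t \<in> {0..\<tau>}" for t
    using Zpos[OF that] Wpos by (simp add: X_def)
  have contX: "continuous_on {0..\<tau>} X"
    unfolding X_def W_def b_def by (intro continuous_intros contP contQ) auto
  have contw: "continuous_on {0..\<tau>} w"
    unfolding w_def by (intro continuous_intros) auto
  have wpos: "0 \<le> w t" for t
    using \<kappa> by (simp add: w_def)
  have key: "X t powr p * w t \<le> W t * source t" if t: "t \<in> {0..\<tau>}" for t
  proof -
    \<comment> \<open>The two power weights add up: \<open>W powr (p - 1)\<close> carries the damping part \<open>\<mu> / 2\<close> of the exponent.\<close>
    have W1: "W t powr (p - 1) * (1 + t) powr (- (d + \<mu> / 2) * (p - 1)) \<le>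
        exp (- (p - 1) * t) * (1 + t) powr (- d * (p - 1))"
    proof -
      have "W t powr (p - 1) * (1 + t) powr (- (d + \<mu> / 2) * (p - 1)) =
          exp ((p - 1) * (- t + \<mu> / 2 * ln (1 + t) - \<mu> / 2 / (1 + t))
            + (- (d + \<mu> / 2) * (p - 1)) * ln (1 + t))"
        using t by (simp add: W_def powr_def exp_add)
      also have "(p - 1) * (- t + \<mu> / 2 * ln (1 + t) - \<mu> / 2 / (1 + t))
            + (- (d + \<mu> / 2) * (p - 1)) * ln (1 + t) =
          - (p - 1) * t + (- d * (p - 1)) * ln (1 + t) - (p - 1) * (\<mu> / 2 / (1 + t))"
        by (simp add: algebra_simps)
      also have "\<dots> \<le> - (p - 1) * t + (- d * (p - 1)) * ln (1 + t)"
        using p \<mu> t by simp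
      also have "exp \<dots> = exp (- (p - 1) * t) * (1 + t) powr (- d * (p - 1))"
        unfolding exp_add using t by (simp add: powr_def)
      finally show ?thesis by simp
    qed
    have "k * X t \<le> W t * P t"
      using mult_left_mono[OF ZP[OF t], of "W t"] Wpos[of t] by (simp add: X_def mult_ac)
    then have "(k * X t) powr p \<le> (W t * P t) powr p"
      using k Xpos[OF t] p by (intro powr_mono2) auto
    then have "k powr p * X t powr p \<le> W t powr p * P t powr p"
      using k Xpos[OF t] Wpos[of t] Ppos(2)[OF t] by (simp add: powr_mult)
    also have "W t powr p = W t * W t powr (p - 1)"
      using Wpos[of t] by (simp add: powr_diff)
    finally have "\<kappa> * (1 + t) powr (- (d + \<mu> / 2) * (p - 1)) * (k powr p * X t powr p) \<le>
        \<kappa> * (1 + t) powr (- (d + \<mu> / 2) * (p - 1)) * (W t * W t powr (p - 1) * P t powr p)"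
      using \<kappa> by (intro mult_left_mono) auto
    also have "\<dots> = \<kappa> * P t powr p * W t * (W t powr (p - 1) * (1 + t) powr (- (d + \<mu> / 2) * (p - 1)))"
      by (simp only: mult_ac)
    also have "\<dots> \<le> \<kappa> * P t powr p * W t * (exp (- (p - 1) * t) * (1 + t) powr (- d * (p - 1)))"
      using \<kappa> Wpos[of t] by (intro mult_left_mono W1) auto
    also have "\<dots> = W t * source t"
      using Ppos(2)[OF t] by (simp add: source_def mult_ac)
    also have "\<kappa> * (1 + t) powr (- (d + \<mu> / 2) * (p - 1)) * (k powr p * X t powr p) = X t powr p * w t"
      by (simp add: w_def mult_ac)
    finally show ?thesis .
  qed
  have contr: "continuous_on {0..\<tau>} (\<lambda>s. X s powr p * w s)"
    using contX contw Xpos p by (intro continuous_intros continuous_on_powr') (auto simp: less_imp_le)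
  have ineq: "X 0 + integral {0..T} (\<lambda>s. X s powr p * w s) \<le> X T" if T: "T \<in> {0..\<tau>}" for T
  proof -
    define I where "I t = integral {0..t} (\<lambda>s. X s powr p * w s)" for t
    define Y where "Y t = X t + - I t" for t
    have dI: "(I has_real_derivative X t powr p * w t) (at t within {0..\<tau>})" if "t \<in> {0..\<tau>}" for t
      unfolding I_def by (rule integral_has_real_derivative[OF contr that])
    have "Y 0 \<le> Y T"
    proof (rule lower_rderiv_nonneg_imp_le[where Y=Y])
      show "continuous_on {0..T} Y"
        unfolding Y_def using T
        by (intro continuous_intros continuous_on_subset[OF contX]
            continuous_on_subset[OF DERIV_continuous_on[OF dI]]) auto
      fix t assume t: "0 \<le> t" "t < T"
      then have t\<tau>: "t \<in> {0..\<tau>}" "t < \<tau>" using T by auto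
      define a where "a = 1 / (1 + t)"
      have dI': "(I has_real_derivative X t powr p * w t) (at_right t)"
      proof -
        have "(I has_real_derivative X t powr p * w t) (at t within {t..\<tau>})"
          by (rule DERIV_subset[OF dI]) (use t t\<tau> in auto)
        then show ?thesis using t\<tau> by (simp add: at_within_Icc_at_right)
      qed
      have "((\<lambda>t. h / (1 + t)) has_real_derivative - (h * (a * a))) (at_right t)" for h
        using t by (auto intro!: derivative_eq_intros simp: a_def field_simps)
      then have da: "((\<lambda>t. \<mu> / 2 / (1 + t)) has_real_derivative - (\<mu> / 2 * (a * a))) (at_right t)" .
      have "((\<lambda>t. - t + h * ln (1 + t)) has_real_derivative - 1 + h * a) (at_right t)" for h
        using t by (auto intro!: derivative_eq_intros simp: a_def)
      from DERIV_chain2[OF DERIV_exp DERIV_diff[OF this[of "\<mu> / 2"] da]]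
      have dW: "(W has_real_derivative W t * (- 1 + \<mu> / 2 * a + \<mu> / 2 * (a * a))) (at_right t)"
        by (simp add: W_def[abs_def])
      have dbQ: "((\<lambda>t. b t * Q t) has_real_derivative - (\<mu> / 2 * (a * a)) * Q t + b t * P t) (at_right t)"
        using DERIV_mult[OF DERIV_add[OF DERIV_const[of 1] da] derQ_right[OF t(1) t\<tau>(2)]]
        by (simp add: b_def[abs_def] mult.commute)
      have "lower_rderiv X (W t * (- 1 + \<mu> / 2 * a + \<mu> / 2 * (a * a)) * (P t + b t * Q t)
          + W t * ((Q t - \<mu> / (1 + t) * P t + source t) + (- (\<mu> / 2 * (a * a)) * Q t + b t * P t))) t"
        unfolding X_def[abs_def]
        by (intro lower_rderiv_mult lower_rderiv_add lower_rderiv_P lower_rderiv_DERIV dW dbQ t t\<tau> Wpos)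
      then have "lower_rderiv X (W t * source t) t"
      proof (rule lower_rderiv_mono)
        \<comment> \<open>In the linear part the terms of order 0 and 1 in \<open>a\<close> cancel.\<close>
        have "W t * (- 1 + \<mu> / 2 * a + \<mu> / 2 * (a * a)) * (P t + b t * Q t)
          + W t * ((Q t - \<mu> / (1 + t) * P t + source t) + (- (\<mu> / 2 * (a * a)) * Q t + b t * P t))
          = W t * source t + W t * (\<mu> / 2 * a\<^sup>2 * P t + \<mu>\<^sup>2 / 4 * (a\<^sup>2 + a ^ 3) * Q t)"
        proof -
          have b: "b t = 1 + \<mu> / 2 * a" "\<mu> / (1 + t) = \<mu> * a" by (auto simp: b_def a_def)
          show ?thesis unfolding b by (simp add: algebra_simps power2_eq_square power3_eq_cube)
        qed
        moreover have "0 \<le> W t * (\<mu> / 2 * a\<^sup>2 * P t + \<mu>\<^sup>2 / 4 * (a\<^sup>2 + a ^ 3) * Q t)"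
          using Wpos[of t] Ppos(2)[OF t\<tau>(1)] Q_pos[OF t\<tau>(1)] \<mu> t
          by (intro mult_nonneg_nonneg add_nonneg_nonneg) (auto simp: a_def)
        ultimately show "W t * source t \<le> W t * (- 1 + \<mu> / 2 * a + \<mu> / 2 * (a * a)) * (P t + b t * Q t)
          + W t * ((Q t - \<mu> / (1 + t) * P t + source t) + (- (\<mu> / 2 * (a * a)) * Q t + b t * P t))"
          by linarith
      qed
      then have "lower_rderiv Y (W t * source t + - (X t powr p * w t)) t"
        unfolding Y_def[abs_def]
        by (rule lower_rderiv_add[OF _ lower_rderiv_DERIV[OF DERIV_minus[OF dI']]])
      then show "lower_rderiv Y 0 t"
        by (rule lower_rderiv_mono) (use key[OF t\<tau>(1)] in simp)
    qed (use T in auto)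
    then show ?thesis by (simp add: Y_def I_def)
  qed
  have "(p - 1) * integral {0..\<tau>} w \<le> X 0 powr (1 - p)"
    by (rule superlinear_integral_inequality[OF \<tau> p _ contX contw wpos _ ineq])
      (use Xpos \<tau> in \<open>auto simp: less_imp_le\<close>)
  also have "X 0 powr (1 - p) \<le> (exp (- \<mu> / 2) * P 0) powr (1 - p)"
  proof (rule powr_mono2')
    show "exp (- \<mu> / 2) * P 0 \<le> X 0"
      using Q0 bpos[of 0] by (simp add: X_def W_def)
  qed (use p Ppos[of 0] \<tau> in auto)
  finally show ?thesis
    unfolding w_def k_def .
qed

end

section \<open>Moments of energy solutions\<close>

text \<open>
  The cutoff in time equals 1 up to time \<open>a\<close>, so that on \<open>[0, a]\<close> the test function does not depend
  on time.
\<close>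
lemma space_time_test_function:
  fixes e :: "'a::euclidean_space"
  assumes \<rho>: "0 \<le> \<rho>" and ab: "0 \<le> a" "a < b" "ereal b < T"
  shows "(\<lambda>z. cut_exp \<rho> e (fst z) * smooth_step (b / (b - a) + (- 1 / (b - a)) * snd z))
    \<in> test_functions (UNIV \<times> lifespan_interval T)" (is "?\<Phi> \<in> _")
proof -
  let ?K = "cball (0::'a) (\<rho> + 1) \<times> {0..b}"
  have "smooth ?\<Phi>"
    by (intro smooth_mult smooth_cut_exp_compose bounded_linear_fst smooth_compose[OF smooth_smooth_step]
        smooth_add smooth_const smooth_linear bounded_linear_snd)
  moreover have "compact ?K" by (intro compact_Times compact_cball compact_Icc)
  moreover have "?K \<subseteq> UNIV \<times> lifespan_interval T"
    using ab by (auto simp: lifespan_interval_def intro: le_less_trans[of "ereal _" "ereal b"])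
  moreover have "?\<Phi> z = 0" if z: "z \<in> UNIV \<times> lifespan_interval T - ?K" for z
  proof (cases "norm (fst z) \<le> \<rho> + 1")
    case False
    then show ?thesis using cut_exp_eq_0[OF \<rho>, of "fst z" e] by simp
  next
    case True
    then have "b < snd z" using z by (cases z) (auto simp: lifespan_interval_def)
    moreover have "b / (b - a) + (- 1 / (b - a)) * snd z = (b - snd z) / (b - a)"
      by (simp add: diff_divide_distrib)
    ultimately have "b / (b - a) + (- 1 / (b - a)) * snd z \<le> 0"
      using ab by (simp add: divide_le_0_iff)
    then show ?thesis by (simp only: smooth_step_0 mult_zero_right)
  qed
  ultimately show ?thesis
    unfolding test_functions_def by blast
qed

text \<open>
  Up to time \<open>\<tau>\<close> the support of \<open>u\<close> stays inside the plateau of the cutoff, with one unit to spare,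
  and there the Laplacian of \<open>\<phi>\<close> equals \<open>\<phi>\<close>. The term with the time derivative of the test function
  drops out.
\<close>
lemma weak_identity_cut_exp:
  fixes u v :: "real \<Rightarrow> 'a::euclidean_space \<Rightarrow> real"
  assumes e: "e \<in> Basis" and R: "0 < R" and \<tau>: "\<tau> \<in> lifespan_interval T"
    and uH1: "\<And>t. t \<in> lifespan_interval T \<Longrightarrow> u t \<in> H1"
    and supp: "spacetime_support (lifespan_interval T) u \<subseteq> {(x, t). 0 \<le> t \<and> norm x \<le> t + R}"
    and wi: "\<And>\<Phi> t. \<Phi> \<in> test_functions (UNIV \<times> lifespan_interval T) \<Longrightarrow> t \<in> lifespan_interval T \<Longrightarrow>
      weak_identity \<mu> p t u v \<Phi>"
    and \<phi>: "\<phi> = cut_exp (\<tau> + R + 1) e" and t: "t \<in> {0..\<tau>}"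
  shows "set_integrable lebesgue (UNIV \<times> {0..t}) (\<lambda>(x, s). \<bar>v s x\<bar> powr p * \<phi> x)"
    and "(LINT x|lebesgue. v t x * \<phi> x) - (LINT x|lebesgue. v 0 x * \<phi> x) =
      (LINT s:{0..t}|lebesgue. LINT x|lebesgue. u s x * \<phi> x)
      - (LINT s:{0..t}|lebesgue. \<mu> / (1 + s) * (LINT x|lebesgue. v s x * \<phi> x))
      + (LINT s:{0..t}|lebesgue. LINT x|lebesgue. \<bar>v s x\<bar> powr p * \<phi> x)"
proof -
  have "ereal \<tau> < T" "0 \<le> \<tau>" using \<tau> by (auto simp: lifespan_interval_def)
  obtain b where b: "\<tau> < b" "ereal b < T"
    using ereal_dense2[OF \<open>ereal \<tau> < T\<close>] by auto
  obtain a where a: "\<tau> < a" "a < b" using dense[OF b(1)] by blast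
  define \<eta> where "\<eta> s = smooth_step (b / (b - a) + (- 1 / (b - a)) * s)" for s
  define \<Phi> where "\<Phi> z = \<phi> (fst z) * \<eta> (snd z)" for z :: "'a \<times> real"
  have \<Phi>: "\<Phi> \<in> test_functions (UNIV \<times> lifespan_interval T)"
    unfolding \<Phi>_def[abs_def] \<eta>_def \<phi>
    using \<open>0 \<le> \<tau>\<close> R a b by (intro space_time_test_function) auto
  have \<eta>1: "\<eta> s = 1" if "s < a" for s
  proof -
    have "b / (b - a) + (- 1 / (b - a)) * s = (b - s) / (b - a)"
      by (simp add: diff_divide_distrib)
    then have "1 \<le> b / (b - a) + (- 1 / (b - a)) * s" using that a by simp
    then show ?thesis unfolding \<eta>_def by (rule smooth_step_1)
  qed
  have J: "s \<in> lifespan_interval T" if "s \<in> {0..t}" for s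
    using that t \<tau> by (auto simp: lifespan_interval_def intro: le_less_trans[of "ereal _" "ereal \<tau>"])
  have \<Phi>1: "\<Phi> (x, s) = \<phi> x" if "s \<in> {0..t}" for x s
    using \<eta>1[of s] that t a by (simp add: \<Phi>_def)
  have d\<Phi>: "deriv (\<lambda>\<tau>. \<Phi> (x, \<tau>)) s = 0" if "s \<in> {0..t}" for x s
  proof -
    have "((\<lambda>\<tau>. \<phi> x) has_real_derivative 0) (at s)" by simp
    then have "((\<lambda>\<tau>. \<Phi> (x, \<tau>)) has_real_derivative 0) (at s)"
      by (rule has_field_derivative_transform_within_open[of _ _ _ "{..<a}"])
        (use that t a \<eta>1 in \<open>auto simp: \<Phi>_def\<close>)
    then show ?thesis by (rule DERIV_imp_deriv)
  qed
  have \<phi>test: "\<phi> \<in> test_functions UNIV"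
    unfolding \<phi> using \<open>0 \<le> \<tau>\<close> R by (intro cut_exp_test_function) auto
  have wg: "(LINT x|lebesgue. weak_grad (u s) x \<bullet> grad (\<lambda>y. \<Phi> (y, s)) x) = - (LINT x|lebesgue. u s x * \<phi> x)"
    if s: "s \<in> {0..t}" for s
  proof -
    have uL2: "u s \<in> L2" using uH1[OF J[OF s]] by (simp add: H1_def)
    define \<Delta> where "\<Delta> x = (\<Sum>i\<in>Basis. frechet_derivative (\<lambda>y. frechet_derivative \<phi> (at y) i) (at x) i)" for x
    have "(LINT x|lebesgue. weak_grad (u s) x \<bullet> grad (\<lambda>y. \<Phi> (y, s)) x) = - (LINT x|lebesgue. u s x * \<Delta> x)"
      using integral_weak_grad_test_function[OF uH1[OF J[OF s]] \<phi>test] s by (simp add: \<Phi>1 \<Delta>_def)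
    also have "(LINT x|lebesgue. u s x * \<Delta> x) = (LINT x|lebesgue. u s x * \<phi> x)"
    proof (rule Bochner_Integration.integral_cong_AE)
      have "continuous_on UNIV \<Delta>"
        unfolding \<Delta>_def using \<phi>test
        by (intro smooth_continuous smooth_sum smooth_partial) (auto simp: test_functions_UNIV)
      then have "\<Delta> \<in> borel_measurable lborel" by (simp add: borel_measurable_continuous_onI)
      from measurable_completion[OF this] uL2
      show "(\<lambda>x. u s x * \<Delta> x) \<in> borel_measurable lebesgue"
        by (intro borel_measurable_times) (simp_all add: L2_real)
      show "(\<lambda>x. u s x * \<phi> x) \<in> borel_measurable lebesgue"
        using integrable_L2_mult[OF uL2 test_functions_L2[OF \<phi>test]] by simp
      show "AE x in lebesgue. u s x * \<Delta> x = u s x * \<phi> x"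
        using AE_zero_outside_spacetime_support[OF supp J[OF s]]
      proof eventually_elim
        case (elim x)
        show ?case
        proof (cases "s + R < norm x")
          case False
          then have "norm x < \<tau> + R + 1" using s t by auto
          then show ?thesis
            using cut_exp_laplacian[OF e, of x "\<tau> + R + 1"] by (simp add: \<Delta>_def \<phi> cut_exp_eq_exp)
        qed (use elim in simp)
      qed
    qed
    finally show ?thesis .
  qed
  have W: "weak_identity \<mu> p t u v \<Phi>"
    using t by (intro wi[OF \<Phi>] J) auto
  have "set_integrable lebesgue (UNIV \<times> {0..t}) (\<lambda>(x, s). \<bar>v s x\<bar> powr p * \<Phi> (x, s))"
    using W by (simp add: weak_identity_def)
  then show "set_integrable lebesgue (UNIV \<times> {0..t}) (\<lambda>(x, s). \<bar>v s x\<bar> powr p * \<phi> x)"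
    unfolding set_integrable_def
    by (rule Bochner_Integration.integrable_cong[THEN iffD1, rotated 2])
      (auto simp: indicator_def \<Phi>1)
  have I1: "(LINT s:{0..t}|lebesgue. LINT x|lebesgue. v s x * deriv (\<lambda>\<tau>. \<Phi> (x, \<tau>)) s) =
      (LINT s:{0..t}|lebesgue. 0)"
    by (rule set_lebesgue_integral_cong) (auto simp: d\<Phi>)
  have I2: "(LINT s:{0..t}|lebesgue. LINT x|lebesgue. weak_grad (u s) x \<bullet> grad (\<lambda>y. \<Phi> (y, s)) x) =
      (LINT s:{0..t}|lebesgue. - (LINT x|lebesgue. u s x * \<phi> x))"
    by (rule set_lebesgue_integral_cong) (auto simp: wg)
  have I3: "(LINT s:{0..t}|lebesgue. LINT x|lebesgue. \<mu> / (1 + s) * v s x * \<Phi> (x, s)) =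
      (LINT s:{0..t}|lebesgue. \<mu> / (1 + s) * (LINT x|lebesgue. v s x * \<phi> x))"
    by (rule set_lebesgue_integral_cong) (auto simp: \<Phi>1 mult.assoc)
  have I4: "(LINT s:{0..t}|lebesgue. LINT x|lebesgue. \<bar>v s x\<bar> powr p * \<Phi> (x, s)) =
      (LINT s:{0..t}|lebesgue. LINT x|lebesgue. \<bar>v s x\<bar> powr p * \<phi> x)"
    by (rule set_lebesgue_integral_cong) (auto simp: \<Phi>1)
  have "0 \<in> {0..t}" "t \<in> {0..t}" using t by auto
  then show "(LINT x|lebesgue. v t x * \<phi> x) - (LINT x|lebesgue. v 0 x * \<phi> x) =
      (LINT s:{0..t}|lebesgue. LINT x|lebesgue. u s x * \<phi> x)
      - (LINT s:{0..t}|lebesgue. \<mu> / (1 + s) * (LINT x|lebesgue. v s x * \<phi> x))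
      + (LINT s:{0..t}|lebesgue. LINT x|lebesgue. \<bar>v s x\<bar> powr p * \<phi> x)"
    using W unfolding weak_identity_def I1 I2 I3 I4
    by (simp add: \<Phi>1 set_lebesgue_integral_def)
qed

text \<open>
  The moments of \<open>u\<close> and \<open>u\<^sub>t\<close> against the cut-off exponential satisfy the inequality of
  the locale \<open>damped_ode\<close>. The lower bound for the nonlinear term holds at almost every time only,
  which suffices for the integrated form.
\<close>
lemma energy_solution_damped_ode:
  fixes u :: "real \<Rightarrow> 'a::euclidean_space \<Rightarrow> real"
  assumes e: "e \<in> Basis" and R: "0 < R" and p: "1 < p" and \<tau>: "\<tau> \<in> lifespan_interval T"
    and sol: "energy_solution \<mu> p T u\<^sub>0 u\<^sub>1 u"
    and supp: "spacetime_support (lifespan_interval T) u \<subseteq> {(x, t). 0 \<le> t \<and> norm x \<le> t + R}"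
    and d: "d = (real DIM('a) - 1) / 2"
    and \<kappa>: "\<kappa> = (1 / 2) powr p * (2 * exp R * (4 * pi * (1 + R)) powr d) powr (1 - p)"
    and \<phi>: "\<phi> = cut_exp (\<tau> + R + 1) e"
  obtains P Q where "continuous_on {0..\<tau>} P"
    "\<And>t. t \<in> {0..\<tau>} \<Longrightarrow> (Q has_real_derivative P t) (at t within {0..\<tau>})"
    "\<And>s t. 0 \<le> s \<Longrightarrow> s \<le> t \<Longrightarrow> t \<le> \<tau> \<Longrightarrow>
      P t - P s \<ge> integral {s..t} (\<lambda>r. Q r - \<mu> / (1 + r) * P r
        + \<kappa> * \<bar>P r\<bar> powr p * exp (- (p - 1) * r) * (1 + r) powr (- d * (p - 1)))"
    "Q 0 = (LINT x|lebesgue. u\<^sub>0 x * \<phi> x)" "P 0 = (LINT x|lebesgue. u\<^sub>1 x * \<phi> x)"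
proof -
  define J where "J = lifespan_interval T"
  obtain v where uH1: "\<And>t. t \<in> J \<Longrightarrow> u t \<in> H1" and v: "cont_curve L2 L2_norm J v"
    and der: "has_L2_derivative u v J"
    and u0: "AE x in lebesgue. u 0 x = u\<^sub>0 x" and v0: "AE x in lebesgue. v 0 x = u\<^sub>1 x"
    and wi: "\<And>\<Phi> t. \<Phi> \<in> test_functions (UNIV \<times> J) \<Longrightarrow> t \<in> J \<Longrightarrow> weak_identity \<mu> p t u v \<Phi>"
    using sol unfolding energy_solution_def Let_def J_def[symmetric] cont_curve_def[of H1] by blast
  have vL2: "v t \<in> L2" if "t \<in> J" for t using v that by (simp add: cont_curve_def)
  have uL2: "u t \<in> L2" if "t \<in> J" for t using uH1[OF that] by (simp add: H1_def)
  have "0 \<le> \<tau>" using \<tau> by (simp add: lifespan_interval_def)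
  have J: "{0..\<tau>} \<subseteq> J"
    using \<tau> by (auto simp: J_def lifespan_interval_def intro: le_less_trans[of "ereal _" "ereal \<tau>"])
  have \<phi>test: "\<phi> \<in> test_functions UNIV"
    unfolding \<phi> using \<open>0 \<le> \<tau>\<close> R by (intro cut_exp_test_function) auto
  have \<phi>L2: "\<phi> \<in> L2" by (rule test_functions_L2[OF \<phi>test])
  define P where "P t = (LINT x|lebesgue. v t x * \<phi> x)" for t
  define Q where "Q t = (LINT x|lebesgue. u t x * \<phi> x)" for t
  define F where "F t = (LINT x|lebesgue. \<bar>v t x\<bar> powr p * \<phi> x)" for t
  define G where "G r = \<kappa> * \<bar>P r\<bar> powr p * exp (- (p - 1) * r) * (1 + r) powr (- d * (p - 1))" for r
  have contP: "continuous_on {0..\<tau>} P"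
    unfolding P_def by (rule continuous_on_subset[OF continuous_pairing_of_cont_curve[OF v \<phi>L2] J])
  have derQ: "(Q has_real_derivative P t) (at t within {0..\<tau>})" if "t \<in> {0..\<tau>}" for t
    unfolding P_def Q_def
    by (rule DERIV_subset[OF pairing_has_derivative_of_has_L2_derivative[OF der uL2 vL2 \<phi>L2] J])
      (use that J in auto)
  have contQ: "continuous_on {0..\<tau>} Q"
    using derQ by (rule DERIV_continuous_on)
  have contmP: "continuous_on {0..\<tau>} (\<lambda>r. \<mu> / (1 + r) * P r)"
    by (intro continuous_intros contP) auto
  have contG: "continuous_on {0..\<tau>} G"
    unfolding G_def using p contP by (intro continuous_intros continuous_on_powr') auto
  have ident: "P t - P 0 = (LINT s:{0..t}|lebesgue. Q s) - (LINT s:{0..t}|lebesgue. \<mu> / (1 + s) * P s)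
      + (LINT s:{0..t}|lebesgue. F s)" if "t \<in> {0..\<tau>}" for t
    unfolding P_def Q_def F_def 
    by (rule weak_identity_cut_exp(2)[OF e R \<tau> _ supp _ \<phi> that]) (use uH1 wi in \<open>simp_all add: J_def\<close>)
  define h where "h z = indicator (UNIV \<times> {0..\<tau>}) z *\<^sub>R (case z of (x, s) \<Rightarrow> \<bar>v s x\<bar> powr p * \<phi> x)" for z :: "'a \<times> real"
  have "\<tau> \<in> {0..\<tau>}" using \<open>0 \<le> \<tau>\<close> by simp
  have "set_integrable lebesgue (UNIV \<times> {0..\<tau>}) (\<lambda>(x, s). \<bar>v s x\<bar> powr p * \<phi> x)"
    by (rule weak_identity_cut_exp(1)[OF e R \<tau> _ supp _ \<phi> \<open>\<tau> \<in> {0..\<tau>}\<close>])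
      (use uH1 wi in \<open>simp_all add: J_def\<close>)
  then have "integrable lebesgue h"
    unfolding set_integrable_def h_def[abs_def] .
  note Fub = lebesgue_Fubini_snd[OF this]
  have hF: "(LINT x|lebesgue. h (x, s)) = indicator {0..\<tau>} s *\<^sub>R F s" for s
    by (cases "s \<in> {0..\<tau>}") (auto simp: h_def F_def)
  have intF: "set_integrable lebesgue {0..\<tau>} F"
    using Fub(2) unfolding hF set_integrable_def .
  have AEint: "AE s in lebesgue. s \<in> {0..\<tau>} \<longrightarrow> integrable lebesgue (\<lambda>x. \<bar>v s x\<bar> powr p * \<phi> x)"
    using Fub(1) by eventually_elim (auto simp: h_def)
  have GF: "G s \<le> F s" if s: "s \<in> {0<..\<tau>}" and int: "integrable lebesgue (\<lambda>x. \<bar>v s x\<bar> powr p * \<phi> x)" for s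
  proof -
    define m where "m = (2 * exp R * (4 * pi * (1 + R)) powr d) * (exp s * (1 + s) powr d)"
    have "s \<in> J" using s J by auto
    have "0 \<le> d" unfolding d using DIM_positive[where 'a='a] by (simp add: Suc_le_eq)
    have \<phi>S: "indicator (cball 0 (s + R)) x * \<phi> x = indicator (cball 0 (s + R)) x * exp (x \<bullet> e)" for x
      unfolding \<phi> using s by (auto simp: indicator_def cut_exp_eq_exp)
    have "(LINT x|lebesgue. indicator (cball 0 (s + R)) x * \<phi> x) \<le> 2 * exp (s + R) * (4 * pi * (s + R)) powr d"
      unfolding \<phi>S d using s R by (intro exp_inner_ball_bound(2)[OF e]) auto
    also have "\<dots> \<le> 2 * exp (s + R) * ((4 * pi * (1 + R)) * (1 + s)) powr d"
    proof (intro mult_left_mono powr_mono2)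
      \<comment> \<open>Trades the radius \<open>s + R\<close> for the time weight \<open>1 + s\<close>.\<close>
      have "s + R \<le> (1 + R) * (1 + s)" using s R by (simp add: algebra_simps)
      then show "4 * pi * (s + R) \<le> 4 * pi * (1 + R) * (1 + s)" by simp
    qed (use s R \<open>0 \<le> d\<close> in auto)
    also have "\<dots> = m"
      using s R by (simp add: m_def powr_mult exp_add)
    finally have m: "(LINT x|lebesgue. indicator (cball 0 (s + R)) x * \<phi> x) \<le> m" .
    have "0 < m" using s R by (simp add: m_def)
    have v0S: "AE x in lebesgue. x \<notin> cball 0 (s + R) \<longrightarrow> v s x = 0"
    proof -
      have "AE x in lebesgue. x \<in> - cball 0 (s + R) \<longrightarrow> v s x = 0"
      proof (rule AE_zero_of_L2_derivative[OF der uL2 vL2 \<open>s \<in> J\<close>])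
        show "0 < s" "{0..s} \<subseteq> J" using s J by auto
        show "- cball (0::'a) (s + R) \<in> sets lebesgue"
          using borel_open[of "- cball (0::'a) (s + R)"]
          by (intro sets_completionI_sets) (simp add: open_Compl)
        fix r assume r: "r \<in> J" "r \<le> s"
        show "AE x in lebesgue. x \<in> - cball 0 (s + R) \<longrightarrow> u r x = 0"
          using AE_zero_outside_spacetime_support[OF supp r(1)[unfolded J_def]]
          by eventually_elim (use r in auto)
      qed
      then show ?thesis by simp
    qed
    have "(\<bar>P s\<bar> / 2) powr p * m powr (1 - p) \<le> F s"
      unfolding P_def F_def
    proof (rule reverse_Hoelder[OF p _ _ int _ m \<open>0 < m\<close> v0S])
      show "0 \<le> \<phi> x" for x unfolding \<phi> by (rule cut_exp_nonneg)
      show "integrable lebesgue (\<lambda>x. v s x * \<phi> x)"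
        by (rule integrable_L2_mult[OF vL2[OF \<open>s \<in> J\<close>] \<phi>L2])
      show "integrable lebesgue (\<lambda>x. indicator (cball 0 (s + R)) x * \<phi> x)"
        unfolding \<phi>S using s R by (intro exp_inner_ball_bound(1)[OF e]) auto
    qed
    also have "(\<bar>P s\<bar> / 2) powr p * m powr (1 - p) = G s"
    proof -
      have "m powr (1 - p) = (2 * exp R * (4 * pi * (1 + R)) powr d) powr (1 - p)
          * (exp s powr (1 - p) * ((1 + s) powr d) powr (1 - p))"
        using s R by (simp add: m_def powr_mult)
      moreover have "exp s powr (1 - p) = exp (- (p - 1) * s)"
        by (simp add: powr_def algebra_simps)
      moreover have "((1 + s) powr d) powr (1 - p) = (1 + s) powr (- d * (p - 1))"
        by (simp add: powr_powr algebra_simps)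
      moreover have "(\<bar>P s\<bar> / 2) powr p = (1 / 2) powr p * \<bar>P s\<bar> powr p"
        by (simp flip: powr_mult)
      ultimately show ?thesis by (simp only: G_def \<kappa> mult_ac)
    qed
    finally show ?thesis .
  qed
  have low: "P t - P s \<ge> integral {s..t} (\<lambda>r. Q r - \<mu> / (1 + r) * P r + G r)"
    if st: "0 \<le> s" "s \<le> t" "t \<le> \<tau>" for s t
  proof -
    have sub: "{s..t} \<subseteq> {0..\<tau>}" "{0..t} \<subseteq> {0..\<tau>}" "{0..s} \<subseteq> {0..\<tau>}" using st by auto
    have diff: "(LINT r:{0..t}|lebesgue. f r) - (LINT r:{0..s}|lebesgue. f r) = integral {s..t} f"
      if f: "set_integrable lebesgue {0..\<tau>} f" for f :: "real \<Rightarrow> real"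
    proof -
      have i: "set_integrable lebesgue {0..t} f" "set_integrable lebesgue {0..s} f"
        by (rule set_integrable_subset[OF f _ sub(2)], simp, rule set_integrable_subset[OF f _ sub(3)], simp)
      show ?thesis
        unfolding set_lebesgue_integral_eq_integral(2)[OF i(1)] set_lebesgue_integral_eq_integral(2)[OF i(2)]
        using Henstock_Kurzweil_Integration.integral_combine[OF st(1,2) set_lebesgue_integral_eq_integral(1)[OF i(1)]]
        by simp
    qed
    note ai = absolutely_integrable_continuous_real
    note ic = integrable_continuous_real[OF continuous_on_subset[OF _ sub(1)]]
    have "integral {s..t} G \<le> integral {s..t} F"
    proof -
      have iG: "set_integrable lebesgue {s..t} G" by (rule set_integrable_subset[OF ai[OF contG] _ sub(1)]) simp
      have iF: "set_integrable lebesgue {s..t} F" by (rule set_integrable_subset[OF intF _ sub(1)]) simp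
      have "(LINT r:{s..t}|lebesgue. G r) \<le> (LINT r:{s..t}|lebesgue. F r)"
      proof (rule set_integral_mono_AE[OF iG iF])
        \<comment> \<open>At time 0 there are no backward difference quotients to control the support of \<open>v\<close>.\<close>
        have "AE r in lebesgue. r \<noteq> (0::real)"
          by (rule AE_completion[OF AE_lborel_singleton])
        with AEint show "AE r\<in>{s..t} in lebesgue. G r \<le> F r"
          by eventually_elim (use sub(1) GF in auto)
      qed
      then show ?thesis
        using set_lebesgue_integral_eq_integral(2)[OF iG] set_lebesgue_integral_eq_integral(2)[OF iF] by simp
    qed
    moreover have "P t - P s = integral {s..t} Q - integral {s..t} (\<lambda>r. \<mu> / (1 + r) * P r) + integral {s..t} F"
      using ident[of t] ident[of s] diff[OF ai[OF contQ]] diff[OF ai[OF contmP]] diff[OF intF] st by simp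
    moreover have "integral {s..t} (\<lambda>r. Q r - \<mu> / (1 + r) * P r + G r) =
        integral {s..t} Q - integral {s..t} (\<lambda>r. \<mu> / (1 + r) * P r) + integral {s..t} G"
      unfolding Henstock_Kurzweil_Integration.integral_add[OF integrable_diff[OF ic[OF contQ] ic[OF contmP]] ic[OF contG]]
        Henstock_Kurzweil_Integration.integral_diff[OF ic[OF contQ] ic[OF contmP]] ..
    ultimately show ?thesis by linarith
  qed
  have "0 \<in> J" using J \<open>0 \<le> \<tau>\<close> by auto
  have init: "(LINT x|lebesgue. w x * \<phi> x) = (LINT x|lebesgue. w' x * \<phi> x)"
    if w: "w \<in> L2" and ae: "AE x in lebesgue. w x = w' x" for w w'
  proof (rule Bochner_Integration.integral_cong_AE)
    show m: "(\<lambda>x. w x * \<phi> x) \<in> borel_measurable lebesgue"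
      using integrable_L2_mult[OF w \<phi>L2] by simp
    show *: "AE x in lebesgue. w x * \<phi> x = w' x * \<phi> x"
      using ae by eventually_elim simp
    show "(\<lambda>x. w' x * \<phi> x) \<in> borel_measurable lebesgue"
      by (rule borel_measurable_AE[OF m *])
  qed
  show ?thesis
  proof (rule that[of P Q])
    show "P t - P s \<ge> integral {s..t} (\<lambda>r. Q r - \<mu> / (1 + r) * P r
        + \<kappa> * \<bar>P r\<bar> powr p * exp (- (p - 1) * r) * (1 + r) powr (- d * (p - 1)))"
      if "0 \<le> s" "s \<le> t" "t \<le> \<tau>" for s t
      using low[OF that] by (simp only: G_def)
    show "Q 0 = (LINT x|lebesgue. u\<^sub>0 x * \<phi> x)"
      unfolding Q_def by (rule init[OF uL2[OF \<open>0 \<in> J\<close>] u0])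
    show "P 0 = (LINT x|lebesgue. u\<^sub>1 x * \<phi> x)"
      unfolding P_def by (rule init[OF vL2[OF \<open>0 \<in> J\<close>] v0])
  qed (use contP derQ in auto)
qed

text \<open>
  The cutoff is invisible to the data, so their moments do not depend on \<open>\<rho>\<close>.
\<close>
lemma exp_pairing_of_nonneg_data:
  fixes f :: "'a::euclidean_space \<Rightarrow> real"
  assumes f: "f \<in> L2" "AE x in lebesgue. 0 \<le> f x" "ess_support f \<subseteq> ball 0 R" "\<not> (AE x in lebesgue. f x = 0)"
    and R: "0 < R"
  shows "R \<le> \<rho> \<Longrightarrow> (LINT x|lebesgue. f x * cut_exp \<rho> e x) = (LINT x|lebesgue. f x * exp (x \<bullet> e))"
    and "0 < (LINT x|lebesgue. f x * exp (x \<bullet> e))"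
proof -
  have mf: "f \<in> borel_measurable lebesgue" using f(1) by (simp add: L2_real)
  have "continuous_on UNIV (\<lambda>x. exp (x \<bullet> e))"
    by (intro continuous_intros)
  then have "(\<lambda>x. exp (x \<bullet> e)) \<in> borel_measurable lborel"
    by (simp add: borel_measurable_continuous_onI)
  from borel_measurable_times[OF mf measurable_completion[OF this]]
  have me: "(\<lambda>x. f x * exp (x \<bullet> e)) \<in> borel_measurable lebesgue" .
  have ic: "integrable lebesgue (\<lambda>x. f x * cut_exp \<rho> e x)" if "R \<le> \<rho>" for \<rho>
    using R that by (intro integrable_L2_mult f test_functions_L2 cut_exp_test_function) simp
  have ae: "AE x in lebesgue. f x * cut_exp \<rho> e x = f x * exp (x \<bullet> e)" if "R \<le> \<rho>" for \<rho>
    using AE_zero_outside_ess_support[of f]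
  proof eventually_elim
    case (elim x)
    show ?case
    proof (cases "x \<in> ess_support f")
      case True
      then have "norm x < R" using f(3) by auto
      then show ?thesis using that by (simp add: cut_exp_eq_exp)
    qed (use elim in simp)
  qed
  show "R \<le> \<rho> \<Longrightarrow> (LINT x|lebesgue. f x * cut_exp \<rho> e x) = (LINT x|lebesgue. f x * exp (x \<bullet> e))"
    by (intro Bochner_Integration.integral_cong_AE borel_measurable_integrable ic ae me)
  have ie: "integrable lebesgue (\<lambda>x. f x * exp (x \<bullet> e))"
    by (rule integrable_cong_AE_imp[OF ic[OF order_refl] me ae[OF order_refl]])
  have nn: "AE x in lebesgue. 0 \<le> f x * exp (x \<bullet> e)"
    using f(2) by eventually_elim simp
  have "0 \<le> (LINT x|lebesgue. f x * exp (x \<bullet> e))"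
    using nn by (rule integral_nonneg_AE)
  moreover have "(LINT x|lebesgue. f x * exp (x \<bullet> e)) \<noteq> 0"
    unfolding integral_nonneg_eq_0_iff_AE[OF ie nn] using f(4) by simp
  ultimately show "0 < (LINT x|lebesgue. f x * exp (x \<bullet> e))" by simp
qed

section \<open>The life span\<close>

lemma integral_power_weight:
  fixes \<tau> \<theta> :: real
  assumes "0 \<le> \<tau>" "\<theta> \<noteq> 1"
  shows "integral {0..\<tau>} (\<lambda>t. (1 + t) powr (- \<theta>)) = ((1 + \<tau>) powr (1 - \<theta>) - 1) / (1 - \<theta>)"
proof -
  have "((\<lambda>t. (1 + t) powr (- \<theta>)) has_integral
      (1 + \<tau>) powr (1 - \<theta>) / (1 - \<theta>) - (1 + 0) powr (1 - \<theta>) / (1 - \<theta>)) {0..\<tau>}"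
  proof (rule fundamental_theorem_of_calculus[OF assms(1)])
    fix t assume "t \<in> {0..\<tau>}"
    then show "((\<lambda>t. (1 + t) powr (1 - \<theta>) / (1 - \<theta>)) has_vector_derivative (1 + t) powr (- \<theta>)) (at t within {0..\<tau>})"
      unfolding has_real_derivative_iff_has_vector_derivative[symmetric]
      using assms(2) by (auto intro!: derivative_eq_intros)
  qed
  then show ?thesis
    by (simp add: integral_unique diff_divide_distrib)
qed

lemma integral_log_weight:
  fixes \<tau> :: real
  assumes "0 \<le> \<tau>"
  shows "integral {0..\<tau>} (\<lambda>t. (1 + t) powr (- 1)) = ln (1 + \<tau>)"
proof -
  have "((\<lambda>t. (1 + t) powr (- 1)) has_integral ln (1 + \<tau>) - ln (1 + 0)) {0..\<tau>}"
  proof (rule fundamental_theorem_of_calculus[OF assms])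
    fix t assume "t \<in> {0..\<tau>}"
    then show "((\<lambda>t. ln (1 + t)) has_vector_derivative (1 + t) powr (- 1)) (at t within {0..\<tau>})"
      unfolding has_real_derivative_iff_has_vector_derivative[symmetric]
      by (auto intro!: derivative_eq_intros simp: powr_minus divide_inverse)
  qed
  then show ?thesis
    by (simp add: integral_unique)
qed

text \<open>
  The constant does not involve \<open>\<epsilon>\<close>: \<open>c\<close> is bounded by the ratio of the initial moments \<open>B\<close> of \<open>g\<close>
  and \<open>A\<close> of \<open>f\<close>, from which \<open>\<epsilon>\<close> cancels, and the initial size of \<open>X\<close> is proportional to \<open>\<epsilon>\<close>.
\<close>
lemma energy_solution_weight_bound:
  fixes f g :: "'a::euclidean_space \<Rightarrow> real" and \<mu> R p :: real
  assumes \<mu>: "0 < \<mu>" and R: "0 < R" and p: "1 < p"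
    and f: "f \<in> L2" "AE x in lebesgue. 0 \<le> f x" "ess_support f \<subseteq> ball 0 R" "\<not> (AE x in lebesgue. f x = 0)"
    and g: "g \<in> L2" "AE x in lebesgue. 0 \<le> g x" "ess_support g \<subseteq> ball 0 R" "\<not> (AE x in lebesgue. g x = 0)"
  obtains C where "0 < C"
    "\<And>\<epsilon> T u \<tau>. 0 < \<epsilon> \<Longrightarrow> energy_solution \<mu> p T (\<lambda>x. \<epsilon> * f x) (\<lambda>x. \<epsilon> * g x) u \<Longrightarrow>
      spacetime_support (lifespan_interval T) u \<subseteq> {(x, t). 0 \<le> t \<and> norm x \<le> t + R} \<Longrightarrow>
      \<tau> \<in> lifespan_interval T \<Longrightarrow>
      integral {0..\<tau>} (\<lambda>t. (1 + t) powr (- ((real DIM('a) + \<mu> - 1) * (p - 1) / 2))) \<le> C * \<epsilon> powr (- (p - 1))"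
proof -
  obtain e :: 'a where e: "e \<in> Basis" using nonempty_Basis by blast
  define A where "A = (LINT x|lebesgue. f x * exp (x \<bullet> e))"
  define B where "B = (LINT x|lebesgue. g x * exp (x \<bullet> e))"
  have A: "0 < A" and B: "0 < B"
    unfolding A_def B_def by (fact exp_pairing_of_nonneg_data(2)[OF f R] exp_pairing_of_nonneg_data(2)[OF g R])+
  define d where "d = (real DIM('a) - 1) / 2"
  define \<kappa> where "\<kappa> = (1 / 2) powr p * (2 * exp R * (4 * pi * (1 + R)) powr d) powr (1 - p)"
  have "0 < \<kappa>" using R by (simp add: \<kappa>_def)
  \<comment> \<open>The first bound gives \<open>P \<ge> c Q\<close> at time 0, the second makes this inequality persist.\<close>
  define c where "c = min (B / A) (1 / (1 + \<mu>))"
  have c: "0 < c" "c * A \<le> B" "c * (c + \<mu>) \<le> 1"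
  proof -
    show "0 < c" using A B \<mu> by (simp add: c_def)
    have "c \<le> B / A" by (simp add: c_def)
    then show "c * A \<le> B" using A by (simp add: field_simps)
    have "c \<le> 1 / (1 + \<mu>)" by (simp add: c_def)
    then have "c * (1 + \<mu>) \<le> 1" using \<mu> by (simp add: pos_le_divide_eq)
    moreover have "1 / (1 + \<mu>) \<le> 1" using \<mu> by simp
    then have "c \<le> 1" using \<open>c \<le> 1 / (1 + \<mu>)\<close> by linarith
    then have "c * (c + \<mu>) \<le> c * (1 + \<mu>)" using \<open>0 < c\<close> by (intro mult_left_mono) auto
    ultimately show "c * (c + \<mu>) \<le> 1" by linarith
  qed
  define k where "k = (p - 1) * (\<kappa> * (c / (c + 1 + \<mu> / 2)) powr p)"
  have "0 < c + 1 + \<mu> / 2" using c \<mu> by simp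
  then have k: "0 < k" using p \<open>0 < \<kappa>\<close> c by (simp add: k_def)
  define C where "C = (exp (- \<mu> / 2) * B) powr (1 - p) / k"
  show ?thesis
  proof (rule that)
    show "0 < C" using B k by (simp add: C_def)
    fix \<epsilon> :: real and T u \<tau>
    assume \<epsilon>: "0 < \<epsilon>" and sol: "energy_solution \<mu> p T (\<lambda>x. \<epsilon> * f x) (\<lambda>x. \<epsilon> * g x) u"
      and supp: "spacetime_support (lifespan_interval T) u \<subseteq> {(x, t). 0 \<le> t \<and> norm x \<le> t + R}"
      and \<tau>: "\<tau> \<in> lifespan_interval T"
    have "0 \<le> \<tau>" using \<tau> by (simp add: lifespan_interval_def)
    define \<phi> where "\<phi> = cut_exp (\<tau> + R + 1) e"
    obtain P Q where PQ: "continuous_on {0..\<tau>} P"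
      "\<And>t. t \<in> {0..\<tau>} \<Longrightarrow> (Q has_real_derivative P t) (at t within {0..\<tau>})"
      "\<And>s t. 0 \<le> s \<Longrightarrow> s \<le> t \<Longrightarrow> t \<le> \<tau> \<Longrightarrow>
        P t - P s \<ge> integral {s..t} (\<lambda>r. Q r - \<mu> / (1 + r) * P r
          + \<kappa> * \<bar>P r\<bar> powr p * exp (- (p - 1) * r) * (1 + r) powr (- d * (p - 1)))"
      "Q 0 = (LINT x|lebesgue. \<epsilon> * f x * \<phi> x)" "P 0 = (LINT x|lebesgue. \<epsilon> * g x * \<phi> x)"
      using energy_solution_damped_ode[OF e R p \<tau> sol supp d_def \<kappa>_def \<phi>_def] by blast
    have "(LINT x|lebesgue. f x * \<phi> x) = A" "(LINT x|lebesgue. g x * \<phi> x) = B"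
      unfolding A_def B_def \<phi>_def using \<open>0 \<le> \<tau>\<close>
      by (simp_all add: exp_pairing_of_nonneg_data(1)[OF f R] exp_pairing_of_nonneg_data(1)[OF g R])
    then have Q_init: "Q 0 = \<epsilon> * A" and P_init: "P 0 = \<epsilon> * B"
      using PQ(4,5) by (simp_all add: mult.assoc)
    interpret damped_ode \<mu> p \<kappa> d \<tau> c P Q
    proof
      show "0 < Q 0" using Q_init A \<epsilon> by simp
      show "c * Q 0 \<le> P 0" using Q_init P_init c \<epsilon> by (simp add: mult.left_commute)
    qed (fact \<mu> p \<open>0 < \<kappa>\<close> \<open>0 \<le> \<tau>\<close> c PQ)+
    define I where "I = integral {0..\<tau>} (\<lambda>t. (1 + t) powr (- (d + \<mu> / 2) * (p - 1)))"
    have "k * I \<le> (exp (- \<mu> / 2) * P 0) powr (1 - p)"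
      using damped_ode_integral_bound unfolding k_def I_def
      by (simp only: integral_mult_right mult.assoc)
    also have "\<dots> = (exp (- \<mu> / 2) * B) powr (1 - p) * \<epsilon> powr (- (p - 1))"
      using B \<epsilon> by (simp add: P_init powr_mult mult_ac)
    finally have "I \<le> C * \<epsilon> powr (- (p - 1))"
      using k by (simp add: C_def field_simps)
    moreover have "- (d + \<mu> / 2) * (p - 1) = - ((real DIM('a) + \<mu> - 1) * (p - 1) / 2)"
      by (simp add: d_def field_simps)
    ultimately show "integral {0..\<tau>} (\<lambda>t. (1 + t) powr (- ((real DIM('a) + \<mu> - 1) * (p - 1) / 2))) \<le> C * \<epsilon> powr (- (p - 1))"
      by (simp only: I_def)
  qed
qed

theorem theorem2p3:
  fixes f g :: "real ^ 'n \<Rightarrow> real" and \<mu> R p N :: real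
  defines "N \<equiv> real CARD('n)"
  assumes "\<mu> > 0" and "R > 0" and "1 < p" and "p \<le> p_G (N + \<mu>)"
    and "f \<in> H1" and "g \<in> L2"
    and "AE x in lebesgue. f x \<ge> 0" and "AE x in lebesgue. g x \<ge> 0"
    and "compact (ess_support f)" and "ess_support f \<subseteq> ball 0 R"
    and "compact (ess_support g)" and "ess_support g \<subseteq> ball 0 R"
    and "\<not> (AE x in lebesgue. f x = 0)" and "\<not> (AE x in lebesgue. g x = 0)"
  shows "\<exists>\<epsilon>\<^sub>0>0. \<exists>C>0. \<forall>\<epsilon>. 0 < \<epsilon> \<and> \<epsilon> \<le> \<epsilon>\<^sub>0 \<longrightarrow>
           (\<forall>(T :: ereal) u.
              energy_solution \<mu> p T (\<lambda>x. \<epsilon> * f x) (\<lambda>x. \<epsilon> * g x) u \<and>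
              spacetime_support (lifespan_interval T) u \<subseteq> {(x, t). 0 \<le> t \<and> norm x \<le> t + R}
              \<longrightarrow> T \<le> ereal (if p < p_G (N + \<mu>)
                             then C * \<epsilon> powr (- (2 * (p - 1) / (2 - (N + \<mu> - 1) * (p - 1))))
                             else exp (C * \<epsilon> powr (- (p - 1)))))"
proof -
  define \<theta> where "\<theta> = (N + \<mu> - 1) * (p - 1) / 2"
  have "1 \<le> N" unfolding N_def by (simp add: Suc_le_eq)
  then have N\<mu>: "0 < N + \<mu> - 1" using \<open>\<mu> > 0\<close> by simp
  have sub: "p < p_G (N + \<mu>) \<longleftrightarrow> \<theta> < 1" and le: "\<theta> \<le> 1"
    using N\<mu> \<open>p \<le> p_G (N + \<mu>)\<close> by (auto simp: p_G_def \<theta>_def field_simps)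
  have "f \<in> L2" using \<open>f \<in> H1\<close> by (simp add: H1_def)
  obtain C where C: "0 < C"
    and bound: "\<And>\<epsilon> T u \<tau>. 0 < \<epsilon> \<Longrightarrow> energy_solution \<mu> p T (\<lambda>x. \<epsilon> * f x) (\<lambda>x. \<epsilon> * g x) u \<Longrightarrow>
      spacetime_support (lifespan_interval T) u \<subseteq> {(x, t). 0 \<le> t \<and> norm x \<le> t + R} \<Longrightarrow>
      \<tau> \<in> lifespan_interval T \<Longrightarrow>
      integral {0..\<tau>} (\<lambda>t. (1 + t) powr (- \<theta>)) \<le> C * \<epsilon> powr (- (p - 1))"
    using energy_solution_weight_bound[OF assms(2-4) \<open>f \<in> L2\<close> assms(8,11,14) assms(7,9,13,15)]
    unfolding \<theta>_def N_def by auto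
  define q where "q = 2 * (p - 1) / (2 - (N + \<mu> - 1) * (p - 1))"
  define C1 where "C1 = (if \<theta> < 1 then (1 + (1 - \<theta>) * C) powr (1 / (1 - \<theta>)) else C)"
  have base: "0 < 1 + (1 - \<theta>) * C" if "\<theta> < 1"
    using that C by (intro add_pos_nonneg) auto
  then have "0 < C1" using C by (auto simp: C1_def)
  \<comment> \<open>The restriction \<open>\<epsilon> \<le> 1\<close> allows the value of the antiderivative at time 0 to be absorbed into the constant.\<close>
  have time: "\<tau> \<le> (if p < p_G (N + \<mu>) then C1 * \<epsilon> powr (- q) else exp (C1 * \<epsilon> powr (- (p - 1))))"
    if \<tau>: "0 \<le> \<tau>" and \<epsilon>: "0 < \<epsilon>" "\<epsilon> \<le> 1"
      and le1: "integral {0..\<tau>} (\<lambda>t. (1 + t) powr (- \<theta>)) \<le> C * \<epsilon> powr (- (p - 1))" for \<tau> \<epsilon>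
  proof (cases "\<theta> < 1")
    case True
    have "1 \<le> \<epsilon> powr (- (p - 1))"
      using powr_mono2'[of "- (p - 1)" \<epsilon> 1] \<epsilon> \<open>1 < p\<close> by simp
    moreover have "(1 + \<tau>) powr (1 - \<theta>) \<le> 1 + (1 - \<theta>) * (C * \<epsilon> powr (- (p - 1)))"
      using le1 True \<tau> by (simp add: integral_power_weight pos_divide_le_eq mult.commute)
    ultimately have "(1 + \<tau>) powr (1 - \<theta>) \<le> (1 + (1 - \<theta>) * C) * \<epsilon> powr (- (p - 1))"
      by (simp add: algebra_simps)
    then have "((1 + \<tau>) powr (1 - \<theta>)) powr (1 / (1 - \<theta>)) \<le>
        ((1 + (1 - \<theta>) * C) * \<epsilon> powr (- (p - 1))) powr (1 / (1 - \<theta>))"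
      using True by (intro powr_mono2) auto
    moreover have "((1 + \<tau>) powr (1 - \<theta>)) powr (1 / (1 - \<theta>)) = 1 + \<tau>"
      using True \<tau> by (simp add: powr_powr)
    moreover have "((1 + (1 - \<theta>) * C) * \<epsilon> powr (- (p - 1))) powr (1 / (1 - \<theta>)) =
        C1 * \<epsilon> powr (- (p - 1) * (1 / (1 - \<theta>)))"
      using True base[OF True] by (simp add: C1_def powr_mult powr_powr)
    moreover have "- (p - 1) * (1 / (1 - \<theta>)) = - q"
      using True by (simp add: q_def \<theta>_def field_simps)
    ultimately have "1 + \<tau> \<le> C1 * \<epsilon> powr (- q)" by simp
    then show ?thesis using True sub by simp
  next
    case False
    then have "\<theta> = 1" using le by simp
    then have "ln (1 + \<tau>) \<le> C1 * \<epsilon> powr (- (p - 1))"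
      using le1 integral_log_weight[OF \<tau>] by (simp add: C1_def)
    then have "exp (ln (1 + \<tau>)) \<le> exp (C1 * \<epsilon> powr (- (p - 1)))" by simp
    then show ?thesis using False sub \<tau> by simp
  qed
  have "T \<le> ereal (if p < p_G (N + \<mu>) then C1 * \<epsilon> powr (- q) else exp (C1 * \<epsilon> powr (- (p - 1))))"
      (is "T \<le> ereal ?X")
    if \<epsilon>: "0 < \<epsilon>" "\<epsilon> \<le> 1"
      and sol: "energy_solution \<mu> p T (\<lambda>x. \<epsilon> * f x) (\<lambda>x. \<epsilon> * g x) u"
      and supp: "spacetime_support (lifespan_interval T) u \<subseteq> {(x, t). 0 \<le> t \<and> norm x \<le> t + R}" for \<epsilon> T u
  proof (rule ccontr)
    assume "\<not> T \<le> ereal ?X"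
    then obtain \<tau> where \<tau>: "ereal ?X < ereal \<tau>" "ereal \<tau> < T"
      using ereal_dense2[of "ereal ?X" T] by (auto simp: not_le)
    have "0 \<le> ?X" using \<open>0 < C1\<close> by simp
    then have "0 \<le> \<tau>" using \<tau>(1) by simp
    then have "\<tau> \<in> lifespan_interval T" using \<tau>(2) by (simp add: lifespan_interval_def)
    from time[OF \<open>0 \<le> \<tau>\<close> \<epsilon> bound[OF \<epsilon>(1) sol supp this]] show False using \<tau>(1) by simp
  qed
  then show ?thesis
    unfolding q_def using \<open>0 < C1\<close> by (intro exI[of _ 1] conjI exI[of _ C1]) auto
qed

end
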